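(* Let $\mu:2^{[n]}\to\mathbb{R}_{\geqslant 0}$ be a $d$-homogeneous probability distribution that is strongly log-concave at $\mathbb{1}$. Let $P_\mu$ denote the transition probability matrix of the Markov chain $\mathcal{M}_\mu$, and let $X(k)$ denote the collection of size-$k$ subsets of $[n]$ which are contained in some element of $\operatorname{supp}(\mu)$. Then for every $0\leqslant k\leqslant d-1$, $P_\mu$ has at most $|X(k)|\leqslant\binom{n}{k}$ eigenvalues of value $>1-\frac{k+1}{d}$. In particular, $\mathcal{M}_\mu$ has spectral gap at least $1/d$, and if $\tau\in\operatorname{supp}(\mu)$ and $0<\epsilon<1$, the total variation mixing time of $\mathcal{M}_\mu$ started at $\tau$ satisfies \[ t_\tau(\epsilon)\leqslant d\log\Big(\frac{1}{\epsilon\,\mu(\tau)}\Big).\]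
   Context: For a distribution $\mu$ on subsets of $[n]=\{1,\dots,n\}$, its generating polynomial is $g_\mu(x)=\sum_{S\subseteq[n]}\mu(S)\prod_{i\in S}x_i$; $\mu$ is $d$-homogeneous if $\mu(S)>0$ implies $|S|=d$. A polynomial $p$ with nonnegative coefficients is log-concave at $\mathbb{1}=(1,\dots,1)$ if it is identically zero or the Hessian of $\log p$ at $\mathbb{1}$ is negative semidefinite. It is strongly log-concave at $\mathbb{1}$ if for every $k\geqslant 0$ and every sequence $1\leqslant i_1,\dots,i_k\leqslant n$ (repetitions allowed), $\partial_{i_1}\cdots\partial_{i_k}p$ is log-concave at $\mathbb{1}$; $\mu$ is strongly log-concave at $\mathbb{1}$ if $g_\mu$ is. The chain $\mathcal{M}_\mu$ has state space $\operatorname{supp}(\mu)=\{S:\mu(S)\neq0\}$; from state $\tau$ it removes an element $i\in\tau$ chosen uniformly at random and then moves to a set $\sigma\supseteq\tau\setminus\{i\}$ in $\operatorname{supp}(\mu)$ chosen with probability proportional to $\mu(\sigma)$. The spectral gap is $1$ minus the second largest eigenvalue. For a chain with transition matrix $P$ and stationary distribution $\pi$, $t_\tau(\epsilon)=\min\{t\in\mathbb{Z}_{\geqslant0}:\|P^t(\tau,\cdot)-\pi\|_1\leqslant\epsilon\}$.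
   Formalization: With the unnormalised ℓ1 norm the mixing bound fails for d=1 (n=2, μ({1})=0.42, ε=0.9), so it is proved in ℓ1 for d≥2 and, for all d≥1, in total variation distance (half of ℓ1); d≥1 is assumed, and a one-state chain has gap 1 by convention. *)

theory Defs
  imports
    "HOL-Analysis.Derivative"
    "HOL-Library.Extended_Real"
    "Jordan_Normal_Form.Char_Poly"
begin

section \<open>Distributions on subsets of \<open>{1..n}\<close>\<close>

text \<open>
  A function on the subsets of \<open>{1..n}\<close> is rendered as \<open>\<mu> :: nat set \<Rightarrow> real\<close>; the values of \<open>\<mu>\<close>
  outside \<open>Pow {1..n}\<close> are never used.
\<close>

definition prob_dist :: "nat \<Rightarrow> (nat set \<Rightarrow> real) \<Rightarrow> bool" where
  "prob_dist n \<mu> \<longleftrightarrow> (\<forall>S\<subseteq>{1..n}. 0 \<le> \<mu> S) \<and> (\<Sum>S\<in>Pow {1..n}. \<mu> S) = 1"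

definition homogeneous :: "nat \<Rightarrow> nat \<Rightarrow> (nat set \<Rightarrow> real) \<Rightarrow> bool" where
  "homogeneous n d \<mu> \<longleftrightarrow> (\<forall>S\<subseteq>{1..n}. 0 < \<mu> S \<longrightarrow> card S = d)"

definition supp :: "nat \<Rightarrow> (nat set \<Rightarrow> real) \<Rightarrow> nat set set" where
  "supp n \<mu> = {S. S \<subseteq> {1..n} \<and> \<mu> S \<noteq> 0}"

definition faces :: "nat \<Rightarrow> (nat set \<Rightarrow> real) \<Rightarrow> nat \<Rightarrow> nat set set" where
  "faces n \<mu> k = {T. T \<subseteq> {1..n} \<and> card T = k \<and> (\<exists>S\<in>supp n \<mu>. T \<subseteq> S)}"

section \<open>Strong log-concavity\<close>

text \<open>
  Real polynomials in \<open>x\<^sub>1, \<dots>, x\<^sub>n\<close> are rendered as the functions they induce on points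
  \<open>x :: nat \<Rightarrow> real\<close>, of which only the coordinates in \<open>{1..n}\<close> matter. A real polynomial is zero
  iff the induced function is, and formal and analytic partial derivatives agree.
\<close>

definition gen_poly :: "nat \<Rightarrow> (nat set \<Rightarrow> real) \<Rightarrow> (nat \<Rightarrow> real) \<Rightarrow> real" where
  "gen_poly n \<mu> x = (\<Sum>S\<in>Pow {1..n}. \<mu> S * (\<Prod>i\<in>S. x i))"

definition partial :: "nat \<Rightarrow> ((nat \<Rightarrow> real) \<Rightarrow> real) \<Rightarrow> (nat \<Rightarrow> real) \<Rightarrow> real" where
  "partial i f x = deriv (\<lambda>t. f (x(i := t))) (x i)"

definition hessian :: "((nat \<Rightarrow> real) \<Rightarrow> real) \<Rightarrow> (nat \<Rightarrow> real) \<Rightarrow> nat \<Rightarrow> nat \<Rightarrow> real" where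
  "hessian f x i j = partial i (partial j f) x"

definition neg_semidef :: "nat \<Rightarrow> (nat \<Rightarrow> nat \<Rightarrow> real) \<Rightarrow> bool" where
  "neg_semidef n H \<longleftrightarrow> (\<forall>v :: nat \<Rightarrow> real. (\<Sum>i=1..n. \<Sum>j=1..n. v i * H i j * v j) \<le> 0)"

definition log_concave_at_one :: "nat \<Rightarrow> ((nat \<Rightarrow> real) \<Rightarrow> real) \<Rightarrow> bool" where
  "log_concave_at_one n p \<longleftrightarrow>
     (\<forall>x. p x = 0) \<or> neg_semidef n (hessian (\<lambda>x. ln (p x)) (\<lambda>_. 1))"

definition strongly_log_concave_at_one :: "nat \<Rightarrow> ((nat \<Rightarrow> real) \<Rightarrow> real) \<Rightarrow> bool" where
  "strongly_log_concave_at_one n p \<longleftrightarrow>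
     (\<forall>is. set is \<subseteq> {1..n} \<longrightarrow> log_concave_at_one n (foldr partial is p))"

section \<open>Finite Markov chains\<close>

text \<open>
  A chain is given by a finite state space \<open>\<Omega>\<close> and a kernel \<open>P\<close>, where \<open>P x y\<close> is the probability of
  moving from \<open>x\<close> to \<open>y\<close>. To apply the matrix library, states are numbered by an arbitrary
  enumeration of \<open>\<Omega>\<close>; the characteristic polynomial does not depend on its choice.
\<close>

definition state_list :: "'s set \<Rightarrow> 's list" where
  "state_list \<Omega> = (SOME xs. distinct xs \<and> set xs = \<Omega>)"

lemma state_list:
  assumes "finite \<Omega>"
  shows "distinct (state_list \<Omega>)" "set (state_list \<Omega>) = \<Omega>"
proof -
  have "\<exists>xs. distinct xs \<and> set xs = \<Omega>"
    using finite_distinct_list[OF assms] by blast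
  then have "distinct (state_list \<Omega>) \<and> set (state_list \<Omega>) = \<Omega>"
    unfolding state_list_def by (rule someI_ex)
  then show "distinct (state_list \<Omega>)" "set (state_list \<Omega>) = \<Omega>" by auto
qed

definition transition_mat :: "'s set \<Rightarrow> ('s \<Rightarrow> 's \<Rightarrow> real) \<Rightarrow> real mat" where
  "transition_mat \<Omega> P = Matrix.mat (card \<Omega>) (card \<Omega>)
     (\<lambda>(i, j). P (state_list \<Omega> ! i) (state_list \<Omega> ! j))"

text \<open>The real eigenvalues with algebraic multiplicity; these are all of them for a reversible chain.\<close>

definition eigenvalues :: "'s set \<Rightarrow> ('s \<Rightarrow> 's \<Rightarrow> real) \<Rightarrow> real multiset" where
  "eigenvalues \<Omega> P = proots (char_poly (transition_mat \<Omega> P))"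

text \<open>
  The second largest eigenvalue is counted with multiplicity. A chain with a single state has no
  second eigenvalue; its spectral gap is \<open>1\<close> by convention.
\<close>

definition spectral_gap :: "'s set \<Rightarrow> ('s \<Rightarrow> 's \<Rightarrow> real) \<Rightarrow> real" where
  "spectral_gap \<Omega> P =
     (if card \<Omega> \<le> 1 then 1 else 1 - rev (sorted_list_of_multiset (eigenvalues \<Omega> P)) ! 1)"

primrec kernel_power :: "'s set \<Rightarrow> ('s \<Rightarrow> 's \<Rightarrow> real) \<Rightarrow> nat \<Rightarrow> 's \<Rightarrow> 's \<Rightarrow> real" where
  "kernel_power \<Omega> P 0 x y = (if x = y then 1 else 0)"
| "kernel_power \<Omega> P (Suc t) x y = (\<Sum>z\<in>\<Omega>. P x z * kernel_power \<Omega> P t z y)"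

definition is_stationary :: "'s set \<Rightarrow> ('s \<Rightarrow> 's \<Rightarrow> real) \<Rightarrow> ('s \<Rightarrow> real) \<Rightarrow> bool" where
  "is_stationary \<Omega> P \<pi> \<longleftrightarrow>
     (\<forall>x\<in>\<Omega>. 0 \<le> \<pi> x) \<and> (\<forall>x. x \<notin> \<Omega> \<longrightarrow> \<pi> x = 0) \<and> (\<Sum>x\<in>\<Omega>. \<pi> x) = 1 \<and>
     (\<forall>y\<in>\<Omega>. (\<Sum>x\<in>\<Omega>. \<pi> x * P x y) = \<pi> y)"

definition stationary_dist :: "'s set \<Rightarrow> ('s \<Rightarrow> 's \<Rightarrow> real) \<Rightarrow> 's \<Rightarrow> real" where
  "stationary_dist \<Omega> P = (THE \<pi>. is_stationary \<Omega> P \<pi>)"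

definition l1_dist :: "'s set \<Rightarrow> ('s \<Rightarrow> real) \<Rightarrow> ('s \<Rightarrow> real) \<Rightarrow> real" where
  "l1_dist \<Omega> p q = (\<Sum>x\<in>\<Omega>. \<bar>p x - q x\<bar>)"

definition tv_dist :: "'s set \<Rightarrow> ('s \<Rightarrow> real) \<Rightarrow> ('s \<Rightarrow> real) \<Rightarrow> real" where
  "tv_dist \<Omega> p q = l1_dist \<Omega> p q / 2"

text \<open>
  The mixing time with respect to a distance \<open>D\<close> (\<^const>\<open>l1_dist\<close> or \<^const>\<open>tv_dist\<close>). It is the least
  time at which the distance is at most \<open>\<epsilon>\<close>, and \<open>\<infinity>\<close> if there is none.
\<close>

definition mixing_time ::
  "('s set \<Rightarrow> ('s \<Rightarrow> real) \<Rightarrow> ('s \<Rightarrow> real) \<Rightarrow> real) \<Rightarrow>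
   's set \<Rightarrow> ('s \<Rightarrow> 's \<Rightarrow> real) \<Rightarrow> 's \<Rightarrow> real \<Rightarrow> enat" where
  "mixing_time D \<Omega> P x \<epsilon> =
     Inf (enat ` {t. D \<Omega> (kernel_power \<Omega> P t x) (stationary_dist \<Omega> P) \<le> \<epsilon>})"

section \<open>The chain of a distribution\<close>

definition chain :: "nat \<Rightarrow> (nat set \<Rightarrow> real) \<Rightarrow> nat set \<Rightarrow> nat set \<Rightarrow> real" where
  "chain n \<mu> \<tau> \<sigma> =
     (\<Sum>i\<in>\<tau>. 1 / real (card \<tau>) *
       (if \<sigma> \<in> supp n \<mu> \<and> \<tau> - {i} \<subseteq> \<sigma>
        then \<mu> \<sigma> / (\<Sum>\<rho> | \<rho> \<in> supp n \<mu> \<and> \<tau> - {i} \<subseteq> \<rho>. \<mu> \<rho>)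
        else 0))"

end

theory Submission
  imports Defs "HOL-Analysis.Function_Topology" "HOL-Library.Ramsey"
begin

text \<open>
  Weight a face \<open>T\<close> by \<open>w T = (d - |T|)! * \<mu>{S. T \<subseteq> S}\<close>, so that \<open>w T\<close> is the sum of the weights of
  the faces covering \<open>T\<close>. Averaging over covering faces (\<open>D\<close>) and summing over covered faces (\<open>U\<close>) are
  then adjoint between consecutive levels, and the chain is \<open>U D / d\<close> on the top level.
  Log-concavity of the derivatives of \<open>g\<^sub>\<mu>\<close> gives, face by face,
  \<open>\<parallel>U h\<parallel>\<^sup>2 \<le> \<parallel>D h\<parallel>\<^sup>2 + \<parallel>h\<parallel>\<^sup>2\<close>. By induction on the level, a function \<open>f\<close> on the top level that is
  orthogonal to everything lifted from the \<open>k\<close>-faces satisfies \<open>\<parallel>D f\<parallel>\<^sup>2 \<le> (d - 1 - k) \<parallel>f\<parallel>\<^sup>2\<close>. These are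
  \<open>|X(k)|\<close> linear conditions, so the eigenvalue count follows from an orthonormal eigenbasis of the
  reversible chain. The case \<open>k = 0\<close> contracts mean-zero functions by \<open>1 - 1/d\<close>, and the mixing time
  bound is obtained at time \<open>\<lfloor>d ln (1 / (\<epsilon> \<mu>(\<tau>)))\<rfloor>\<close>.
\<close>

section \<open>Weighted inner products\<close>

definition weighted_ip :: "'a set \<Rightarrow> ('a \<Rightarrow> real) \<Rightarrow> ('a \<Rightarrow> real) \<Rightarrow> ('a \<Rightarrow> real) \<Rightarrow> real" where
  "weighted_ip A w f g = (\<Sum>x\<in>A. w x * f x * g x)"

lemma weighted_ip_commute: "weighted_ip A w f g = weighted_ip A w g f"
  by (simp add: weighted_ip_def mult_ac)

lemma weighted_ip_add_left:
  "weighted_ip A w (\<lambda>x. f x + g x) h = weighted_ip A w f h + weighted_ip A w g h"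
  by (simp add: weighted_ip_def algebra_simps sum.distrib)

lemma weighted_ip_add_right:
  "weighted_ip A w h (\<lambda>x. f x + g x) = weighted_ip A w h f + weighted_ip A w h g"
  by (simp add: weighted_ip_def algebra_simps sum.distrib)

lemma weighted_ip_diff_left:
  "weighted_ip A w (\<lambda>x. f x - g x) h = weighted_ip A w f h - weighted_ip A w g h"
  by (simp add: weighted_ip_def algebra_simps sum_subtractf)

lemma weighted_ip_scale_left: "weighted_ip A w (\<lambda>x. c * f x) h = c * weighted_ip A w f h"
  by (simp add: weighted_ip_def algebra_simps sum_distrib_left)

lemma weighted_ip_scale_right: "weighted_ip A w h (\<lambda>x. c * f x) = c * weighted_ip A w h f"
  by (simp add: weighted_ip_def algebra_simps sum_distrib_left)

lemma weighted_ip_sum_left: "weighted_ip A w (\<lambda>x. \<Sum>i\<in>I. f i x) h = (\<Sum>i\<in>I. weighted_ip A w (f i) h)"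
  by (simp add: weighted_ip_def sum_distrib_left sum_distrib_right) (rule sum.swap)

lemma weighted_ip_sum_right: "weighted_ip A w h (\<lambda>x. \<Sum>i\<in>I. f i x) = (\<Sum>i\<in>I. weighted_ip A w h (f i))"
  by (simp add: weighted_ip_commute[of _ _ h] weighted_ip_sum_left)

lemma weighted_ip_cong:
  assumes "\<And>x. x \<in> A \<Longrightarrow> f x = f' x" and "\<And>x. x \<in> A \<Longrightarrow> g x = g' x"
  shows "weighted_ip A w f g = weighted_ip A w f' g'"
  using assms by (simp add: weighted_ip_def)

lemma weighted_ip_indicator:
  "finite A \<Longrightarrow> x \<in> A \<Longrightarrow> weighted_ip A w f (indicator {x}) = w x * f x"
  by (simp add: weighted_ip_def indicator_def if_distrib[of "(*) _"] cong: if_cong)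

lemma weighted_ip_nonneg:
  assumes "\<And>x. x \<in> A \<Longrightarrow> 0 \<le> w x"
  shows "0 \<le> weighted_ip A w f f"
  unfolding weighted_ip_def using assms by (intro sum_nonneg) (simp add: mult.assoc)

lemma weighted_ip_Cauchy_Schwarz:
  assumes "\<And>x. x \<in> A \<Longrightarrow> 0 \<le> w x"
  shows "(weighted_ip A w f g)\<^sup>2 \<le> weighted_ip A w f f * weighted_ip A w g g"
proof -
  have sum_sqrt_weights: "(\<Sum>x\<in>A. (sqrt (w x) * f x) * (sqrt (w x) * g x)) = weighted_ip A w f g" for f g
    unfolding weighted_ip_def using assms
    by (intro sum.cong refl) (simp add: algebra_simps flip: real_sqrt_mult)
  show ?thesis
    using Cauchy_Schwarz_ineq_sum[of "\<lambda>x. sqrt (w x) * f x" "\<lambda>x. sqrt (w x) * g x" A]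
    by (simp only: sum_sqrt_weights power2_eq_square[of "_ * _"])
qed

lemma continuous_on_weighted_ip [continuous_intros]:
  fixes f g :: "'b :: topological_space \<Rightarrow> 'a \<Rightarrow> real"
  assumes "\<And>x. continuous_on S (\<lambda>y. f y x)" and "\<And>x. continuous_on S (\<lambda>y. g y x)"
  shows "continuous_on S (\<lambda>y. weighted_ip A w (f y) (g y))"
  unfolding weighted_ip_def by (intro continuous_intros assms)

lemma exists_nonzero_solution:
  fixes a :: "'j \<Rightarrow> 'i \<Rightarrow> real"
  assumes "finite J" and "finite I" and card: "card J < card I"
  shows "\<exists>c. (\<exists>i\<in>I. c i \<noteq> 0) \<and> (\<forall>j\<in>J. (\<Sum>i\<in>I. a j i * c i) = 0)"
proof -
  define m where "m = card I"
  obtain p where bij_p: "bij_betw p {0..<m} I"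
    using ex_bij_betw_nat_finite[OF \<open>finite I\<close>] by (auto simp: m_def)
  obtain r where bij_r: "bij_betw r {0..<card J} J"
    using ex_bij_betw_nat_finite[OF \<open>finite J\<close>] by blast
  \<comment> \<open>The system is padded with zero equations to a singular square one.\<close>
  define row where "row k = vec m (\<lambda>i. if k < card J then a (r k) (p i) else 0)" for k
  define M where "M = mat\<^sub>r m m (\<lambda>k. if k = m - 1 then 0\<^sub>v m else row k)"
  have M_carrier: "M \<in> carrier_mat m m" by (simp add: M_def)
  have "det M = 0" unfolding M_def using card by (intro det_row_0) (auto simp: m_def row_def)
  then obtain v where v_kernel: "v \<in> carrier_vec m" "v \<noteq> 0\<^sub>v m" "M *\<^sub>v v = 0\<^sub>v m"
    using det_0_iff_vec_prod_zero_field[OF M_carrier] by blast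
  define c where "c i = vec_index v (the_inv_into {0..<m} p i)" for i
  have c_eq: "c (p i) = vec_index v i" if "i < m" for i
    using bij_p that by (simp add: c_def the_inv_into_f_f bij_betw_def)
  have "\<exists>i\<in>I. c i \<noteq> 0"
  proof -
    obtain i where "i < m" "vec_index v i \<noteq> 0"
      using v_kernel(1,2) by (metis carrier_vecD eq_vecI index_zero_vec)
    then show ?thesis using c_eq bij_betwE[OF bij_p] by (metis atLeast0LessThan lessThan_iff)
  qed
  moreover have "(\<Sum>i\<in>I. a j i * c i) = 0" if "j \<in> J" for j
  proof -
    have "j \<in> r ` {0..<card J}" using bij_r that by (simp add: bij_betw_imp_surj_on)
    then obtain k where k_index: "k < card J" "j = r k" by auto
    have "(\<Sum>i\<in>I. a j i * c i) = (\<Sum>i = 0..<m. a j (p i) * vec_index v i)"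
      unfolding sum.reindex_bij_betw[OF bij_p, symmetric] by (simp add: c_eq)
    also have "\<dots> = vec_index (M *\<^sub>v v) k"
      using k_index card v_kernel(1) by (simp add: M_def row_def m_def scalar_prod_def)
    finally show ?thesis using v_kernel(3) k_index(1) card by (simp add: m_def)
  qed
  ultimately show ?thesis by blast
qed

lemma compact_if_closed_and_pointwise_bounded:
  fixes S :: "('s \<Rightarrow> real) set"
  assumes "closed S" and "\<And>f x. f \<in> S \<Longrightarrow> \<bar>f x\<bar> \<le> M x"
  shows "compact S"
proof -
  have "compactin (product_topology (\<lambda>_. euclidean) UNIV) (PiE UNIV (\<lambda>x. {- M x..M x}))"
    by (subst compactin_PiE) auto
  then have "compact (PiE UNIV (\<lambda>x. {- M x..M x}))"
    by (simp add: euclidean_product_topology)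
  moreover have "S \<subseteq> PiE UNIV (\<lambda>x. {- M x..M x})"
    using assms(2) by (auto simp: abs_le_iff) (metis minus_le_iff)
  ultimately show ?thesis
    using assms(1) by (metis compact_Int_closed inf.absorb_iff2)
qed

locale weighted_space =
  fixes \<Omega> :: "'s set" and w :: "'s \<Rightarrow> real"
  assumes finite_space: "finite \<Omega>" and weight_pos: "\<And>x. x \<in> \<Omega> \<Longrightarrow> 0 < w x"
begin

abbreviation ip :: "('s \<Rightarrow> real) \<Rightarrow> ('s \<Rightarrow> real) \<Rightarrow> real" where
  "ip \<equiv> weighted_ip \<Omega> w"

lemma ip_nonneg: "0 \<le> ip f f"
  by (simp add: weighted_ip_nonneg weight_pos less_imp_le)

lemma weighted_square_le_ip:
  assumes "x \<in> \<Omega>"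
  shows "w x * (f x)\<^sup>2 \<le> ip f f"
proof -
  have "w x * f x * f x \<le> ip f f"
    unfolding weighted_ip_def using finite_space assms
    by (intro member_le_sum) (auto simp: weight_pos less_imp_le mult.assoc)
  then show ?thesis by (simp add: power2_eq_square mult.assoc)
qed

lemma ip_eq_0D:
  assumes "ip f f = 0" and "x \<in> \<Omega>"
  shows "f x = 0"
  using weighted_square_le_ip[OF assms(2), of f] assms(1) weight_pos[OF assms(2)]
  by (simp add: mult_le_0_iff)

definition orthogonal_sphere :: "('s \<Rightarrow> real) set \<Rightarrow> ('s \<Rightarrow> real) set" where
  "orthogonal_sphere \<Phi> = {f. ip f f = 1 \<and> (\<forall>g\<in>\<Phi>. ip f g = 0) \<and> (\<forall>x. x \<notin> \<Omega> \<longrightarrow> f x = 0)}"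

lemma compact_orthogonal_sphere: "compact (orthogonal_sphere \<Phi>)"
proof (rule compact_if_closed_and_pointwise_bounded)
  have "orthogonal_sphere \<Phi>
      = {f. ip f f = 1} \<inter> (\<Inter>g\<in>\<Phi>. {f. ip f g = 0}) \<inter> (\<Inter>x\<in>- \<Omega>. {f. f x = 0})"
    by (auto simp: orthogonal_sphere_def)
  also have "closed \<dots>"
    by (intro closed_Int closed_INT ballI closed_Collect_eq continuous_intros) auto
  finally show "closed (orthogonal_sphere \<Phi>)" .
  show "\<bar>f x\<bar> \<le> (if x \<in> \<Omega> then sqrt (1 / w x) else 0)" if "f \<in> orthogonal_sphere \<Phi>" for f x
  proof (cases "x \<in> \<Omega>")
    case True
    then have "(f x)\<^sup>2 \<le> 1 / w x"
      using that weighted_square_le_ip[OF True, of f] weight_pos[OF True]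
      by (simp add: orthogonal_sphere_def field_simps)
    then show ?thesis using True by (simp add: real_le_rsqrt)
  qed (use that in \<open>auto simp: orthogonal_sphere_def\<close>)
qed

lemma normalise_to_orthogonal_sphere:
  assumes orthogonal: "\<And>g. g \<in> \<Phi> \<Longrightarrow> ip f g = 0" and nonzero: "ip f f \<noteq> 0"
  obtains g c where "g \<in> orthogonal_sphere \<Phi>" "\<And>x. x \<in> \<Omega> \<Longrightarrow> f x = c * g x" "ip f f = c\<^sup>2"
proof -
  define c where "c = sqrt (ip f f)"
  have c_pos: "c > 0" "ip f f = c\<^sup>2" using nonzero ip_nonneg[of f] by (simp_all add: c_def)
  define g where "g x = (if x \<in> \<Omega> then (1 / c) * f x else 0)" for x
  have ip_g: "ip g h = (1 / c) * ip f h" for h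
    unfolding weighted_ip_scale_left[symmetric] by (rule weighted_ip_cong) (auto simp: g_def)
  have "ip g g = (1 / c) * ((1 / c) * ip f f)"
    by (simp only: ip_g weighted_ip_commute[of _ _ f g])
  then have "ip g g = 1" using c_pos by (simp add: power2_eq_square)
  then have "g \<in> orthogonal_sphere \<Phi>"
    using orthogonal by (simp add: orthogonal_sphere_def ip_g) (simp add: g_def)
  moreover have "f x = c * g x" if "x \<in> \<Omega>" for x using that c_pos by (simp add: g_def)
  ultimately show thesis using c_pos that by blast
qed

lemma orthogonal_sphere_nonempty:
  assumes "finite \<Phi>" and "card \<Phi> < card \<Omega>"
  shows "orthogonal_sphere \<Phi> \<noteq> {}"
proof -
  obtain f where f_solution: "\<exists>x\<in>\<Omega>. f x \<noteq> 0" "\<forall>g\<in>\<Phi>. (\<Sum>x\<in>\<Omega>. (w x * g x) * f x) = 0"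
    using exists_nonzero_solution[OF assms(1) finite_space assms(2), of "\<lambda>g x. w x * g x"] by blast
  have "ip f g = 0" if "g \<in> \<Phi>" for g
    using f_solution(2) that unfolding weighted_ip_commute[of _ _ f] by (simp add: weighted_ip_def)
  moreover have "ip f f \<noteq> 0" using f_solution(1) ip_eq_0D by blast
  ultimately show ?thesis by (rule normalise_to_orthogonal_sphere) auto
qed

end

section \<open>Spectral theory of reversible kernels\<close>

definition kernel_op :: "'s set \<Rightarrow> ('s \<Rightarrow> 's \<Rightarrow> real) \<Rightarrow> ('s \<Rightarrow> real) \<Rightarrow> 's \<Rightarrow> real" where
  "kernel_op \<Omega> K f x = (\<Sum>y\<in>\<Omega>. K x y * f y)"

lemma kernel_op_add: "kernel_op \<Omega> K (\<lambda>x. f x + g x) = (\<lambda>x. kernel_op \<Omega> K f x + kernel_op \<Omega> K g x)"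
  by (simp add: kernel_op_def fun_eq_iff algebra_simps sum.distrib)

lemma kernel_op_scale: "kernel_op \<Omega> K (\<lambda>x. c * f x) = (\<lambda>x. c * kernel_op \<Omega> K f x)"
  by (simp add: kernel_op_def fun_eq_iff algebra_simps sum_distrib_left)

lemma kernel_op_sum: "kernel_op \<Omega> K (\<lambda>x. \<Sum>i\<in>I. f i x) = (\<lambda>x. \<Sum>i\<in>I. kernel_op \<Omega> K (f i) x)"
  unfolding kernel_op_def sum_distrib_left by (rule ext) (rule sum.swap)

lemma kernel_op_cong: "(\<And>x. x \<in> \<Omega> \<Longrightarrow> f x = g x) \<Longrightarrow> kernel_op \<Omega> K f = kernel_op \<Omega> K g"
  by (simp add: kernel_op_def fun_eq_iff)

lemma kernel_op_indicator: "finite \<Omega> \<Longrightarrow> y \<in> \<Omega> \<Longrightarrow> kernel_op \<Omega> K (indicator {y}) x = K x y"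
  by (simp add: kernel_op_def indicator_def if_distrib[of "(*) _"] cong: if_cong)

lemma linear_coeff_eq_0_if_quadratic_nonneg:
  fixes a b :: real
  assumes "\<And>t. 0 \<le> a * t\<^sup>2 + b * t"
  shows "b = 0"
proof (rule DERIV_local_min[where d = 1])
  show "((\<lambda>t. a * t\<^sup>2 + b * t) has_real_derivative b) (at 0)"
    by (auto intro!: derivative_eq_intros)
qed (use assms in auto)

lemma proots_prod_linear_factors: "proots (\<Prod>a\<leftarrow>xs. [:- a, 1:]) = mset (xs :: real list)"
proof -
  have "proots (\<Prod>a\<leftarrow>xs. [:- a, 1:]) = (\<Sum>p\<leftarrow>map (\<lambda>a. [:- a, 1:]) xs. proots p)"
    by (subst proots_prod_list[of "map _ xs", simplified map_ident]) auto
  also have "\<dots> = mset xs" by (induction xs) simp_all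
  finally show ?thesis .
qed

lemma second_largest_le:
  fixes M :: "real multiset"
  assumes "size {#e \<in># M. e > a#} \<le> 1" "2 \<le> size M"
  shows "rev (sorted_list_of_multiset M) ! 1 \<le> a"
proof (rule ccontr)
  define xs where "xs = rev (sorted_list_of_multiset M)"
  have mset_xs: "mset xs = M" by (simp add: xs_def)
  then have "2 \<le> length xs" using assms(2) by (metis size_mset)
  then obtain x y zs where xs_eq: "xs = x # y # zs"
    by (metis One_nat_def Suc_1 Suc_le_length_iff)
  have "sorted (rev xs)" by (simp add: xs_def)
  then have "y \<le> x" by (simp add: xs_eq sorted_append)
  moreover assume "\<not> ?thesis"
  then have "y > a" by (simp add: xs_eq flip: xs_def)
  ultimately have "size {#e \<in># M. e > a#} \<ge> 2" by (simp add: xs_eq flip: mset_xs)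
  then show False using assms(1) by simp
qed

lemma char_poly_if_diagonalised:
  fixes A :: "'a :: field mat"
  assumes carrier: "A \<in> carrier_mat n n" "F \<in> carrier_mat n n" "G \<in> carrier_mat n n"
    and inverse: "G * F = 1\<^sub>m n" and eigen: "A * F = F * mat_diag n l"
  shows "char_poly A = (\<Prod>a\<leftarrow>map l [0..<n]. [:- a, 1:])"
proof -
  have right_inverse: "F * G = 1\<^sub>m n" using mat_mult_left_right_inverse inverse carrier by blast
  then have "A = (A * F) * G" using carrier by simp
  then have "similar_mat A (mat_diag n l)"
    using carrier right_inverse inverse eigen by (intro similar_matI[of _ _ F G n]) auto
  then have "char_poly A = char_poly (mat_diag n l)" by (rule char_poly_similar)
  also have "\<dots> = (\<Prod>a\<leftarrow>diag_mat (mat_diag n l). [:- a, 1:])"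
    by (rule char_poly_upper_triangular[OF mat_diag_dim]) (simp add: upper_triangular_def mat_diag_def)
  also have "diag_mat (mat_diag n l) = map l [0..<n]" by (simp add: diag_mat_def mat_diag_def)
  finally show ?thesis .
qed

lemma sum_state_list:
  assumes "finite \<Omega>"
  shows "(\<Sum>i = 0..<card \<Omega>. f (state_list \<Omega> ! i)) = sum f \<Omega>"
proof (rule sum.reindex_bij_betw)
  have "length (state_list \<Omega>) = card \<Omega>" using state_list[OF assms] by (metis distinct_card)
  then show "bij_betw ((!) (state_list \<Omega>)) {0..<card \<Omega>} \<Omega>"
    using state_list[OF assms] by (intro bij_betw_nth) (auto simp: lessThan_atLeast0)
qed

lemma eigenvalues_eq_if_biorthogonal_eigenfamily:
  assumes finite_space: "finite \<Omega>"
    and biorthogonal: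
      "\<And>i j. i < card \<Omega> \<Longrightarrow> j < card \<Omega> \<Longrightarrow> (\<Sum>x\<in>\<Omega>. \<psi> i x * \<phi> j x) = (if i = j then 1 else 0)"
    and eigen: "\<And>i x. i < card \<Omega> \<Longrightarrow> x \<in> \<Omega> \<Longrightarrow> kernel_op \<Omega> K (\<phi> i) x = l i * \<phi> i x"
  shows "eigenvalues \<Omega> K = mset (map l [0..<card \<Omega>])"
proof -
  let ?n = "card \<Omega>" and ?s = "\<lambda>i. state_list \<Omega> ! i"
  have state_mem: "?s i \<in> \<Omega>" if "i < ?n" for i
    using that state_list[OF finite_space] by (metis distinct_card nth_mem)
  define F where "F = Matrix.mat ?n ?n (\<lambda>(i, j). \<phi> j (?s i))"
  define G where "G = Matrix.mat ?n ?n (\<lambda>(i, j). \<psi> i (?s j))"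
  have FG_carrier: "F \<in> carrier_mat ?n ?n" "G \<in> carrier_mat ?n ?n" by (simp_all add: F_def G_def)
  have T_carrier: "transition_mat \<Omega> K \<in> carrier_mat ?n ?n" by (simp add: transition_mat_def)
  have "G * F = 1\<^sub>m ?n"
    by (rule eq_matI) (simp_all add: F_def G_def scalar_prod_def biorthogonal
        sum_state_list[OF finite_space, of "\<lambda>x. \<psi> _ x * \<phi> _ x"])
  moreover have "transition_mat \<Omega> K * F = F * mat_diag ?n l"
    unfolding mat_diag_mult_right[OF FG_carrier(1)]
  proof (rule eq_matI)
    fix i j assume "i < dim_row (Matrix.mat ?n ?n (\<lambda>(i, j). F $$ (i, j) * l j))"
      and "j < dim_col (Matrix.mat ?n ?n (\<lambda>(i, j). F $$ (i, j) * l j))"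
    then have ij_less: "i < ?n" "j < ?n" by simp_all
    then have "(transition_mat \<Omega> K * F) $$ (i, j) = (\<Sum>k = 0..<?n. K (?s i) (?s k) * \<phi> j (?s k))"
      by (simp add: F_def transition_mat_def scalar_prod_def)
    also have "\<dots> = kernel_op \<Omega> K (\<phi> j) (?s i)"
      unfolding kernel_op_def by (rule sum_state_list[OF finite_space])
    finally show "(transition_mat \<Omega> K * F) $$ (i, j)
        = Matrix.mat ?n ?n (\<lambda>(i, j). F $$ (i, j) * l j) $$ (i, j)"
      using ij_less by (simp add: eigen state_mem F_def)
  qed (use T_carrier FG_carrier in auto)
  ultimately have "char_poly (transition_mat \<Omega> K) = (\<Prod>a\<leftarrow>map l [0..<?n]. [:- a, 1:])"
    by (rule char_poly_if_diagonalised[OF T_carrier FG_carrier])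
  then show ?thesis by (simp only: eigenvalues_def proots_prod_linear_factors)
qed

locale reversible_kernel = weighted_space +
  fixes K :: "'a \<Rightarrow> 'a \<Rightarrow> real"
  assumes reversible: "\<And>x y. x \<in> \<Omega> \<Longrightarrow> y \<in> \<Omega> \<Longrightarrow> w x * K x y = w y * K y x"
begin

abbreviation app :: "('a \<Rightarrow> real) \<Rightarrow> 'a \<Rightarrow> real" where
  "app \<equiv> kernel_op \<Omega> K"

lemma ip_app_left: "ip (app f) g = ip f (app g)"
proof -
  have "ip (app f) g = (\<Sum>x\<in>\<Omega>. \<Sum>y\<in>\<Omega>. (w x * K x y) * f y * g x)"
    by (simp add: weighted_ip_def kernel_op_def sum_distrib_left sum_distrib_right mult_ac)
  also have "\<dots> = (\<Sum>x\<in>\<Omega>. \<Sum>y\<in>\<Omega>. (w y * K y x) * f y * g x)"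
    by (intro sum.cong refl) (simp add: reversible)
  also have "\<dots> = (\<Sum>y\<in>\<Omega>. \<Sum>x\<in>\<Omega>. (w y * K y x) * f y * g x)"
    by (rule sum.swap)
  also have "\<dots> = ip f (app g)"
    by (simp add: weighted_ip_def kernel_op_def sum_distrib_left mult_ac)
  finally show ?thesis .
qed

lemma Rayleigh_maximiser_exists:
  assumes "finite \<Phi>" and "card \<Phi> < card \<Omega>"
  obtains f where "f \<in> orthogonal_sphere \<Phi>"
    and "\<And>g. (\<And>h. h \<in> \<Phi> \<Longrightarrow> ip g h = 0) \<Longrightarrow> ip g (app g) \<le> ip f (app f) * ip g g"
proof -
  have "continuous_on (orthogonal_sphere \<Phi>) (\<lambda>f. ip f (app f))"
    unfolding kernel_op_def
    by (intro continuous_intros continuous_on_subset[OF continuous_on_product_coordinates]) auto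
  then obtain f where f_sphere: "f \<in> orthogonal_sphere \<Phi>"
    and max: "\<And>g. g \<in> orthogonal_sphere \<Phi> \<Longrightarrow> ip g (app g) \<le> ip f (app f)"
    using continuous_attains_sup[OF compact_orthogonal_sphere orthogonal_sphere_nonempty[OF assms]]
    by metis
  have "ip g (app g) \<le> ip f (app f) * ip g g" if orthogonal: "\<And>h. h \<in> \<Phi> \<Longrightarrow> ip g h = 0" for g
  proof (cases "ip g g = 0")
    case True
    then have "ip g (app g) = ip (\<lambda>_. 0) (app g)" by (intro weighted_ip_cong) (auto dest: ip_eq_0D)
    then show ?thesis using True by (simp add: weighted_ip_def)
  next
    case False
    obtain g' c where scaled: "g' \<in> orthogonal_sphere \<Phi>" "\<And>x. x \<in> \<Omega> \<Longrightarrow> g x = c * g' x" "ip g g = c\<^sup>2"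
      using normalise_to_orthogonal_sphere[OF orthogonal False] by blast
    have "app g = (\<lambda>x. c * app g' x)"
      unfolding kernel_op_scale[symmetric] using scaled(2) by (rule kernel_op_cong)
    then have "ip g (app g) = ip (\<lambda>x. c * g' x) (\<lambda>x. c * app g' x)"
      using scaled(2) by (intro weighted_ip_cong) auto
    also have "\<dots> = c\<^sup>2 * ip g' (app g')"
      by (simp add: weighted_ip_scale_left weighted_ip_scale_right power2_eq_square)
    also have "\<dots> \<le> c\<^sup>2 * ip f (app f)" using max[OF scaled(1)] by (simp add: mult_left_mono)
    finally show ?thesis by (simp add: scaled(3) mult.commute)
  qed
  with f_sphere that show thesis by blast
qed

lemma Rayleigh_maximiser_stationary:
  assumes f_sphere: "f \<in> orthogonal_sphere \<Phi>"
    and max: "\<And>g. (\<And>h. h \<in> \<Phi> \<Longrightarrow> ip g h = 0) \<Longrightarrow> ip g (app g) \<le> e * ip g g"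
    and e_eq: "e = ip f (app f)"
    and orthogonal: "\<And>h. h \<in> \<Phi> \<Longrightarrow> ip g h = 0"
  shows "ip (app f) g = e * ip f g"
proof -
  have "0 \<le> (e * ip g g - ip g (app g)) * t\<^sup>2 + 2 * (e * ip f g - ip (app f) g) * t" for t
  proof -
    let ?g = "\<lambda>x. f x + t * g x"
    have "ip ?g (app ?g) \<le> e * ip ?g ?g"
      using f_sphere orthogonal
      by (intro max) (simp add: orthogonal_sphere_def weighted_ip_add_left weighted_ip_scale_left)
    moreover have "ip f f = 1" using f_sphere by (simp add: orthogonal_sphere_def)
    moreover have "ip g (app f) = ip f (app g)" by (metis ip_app_left weighted_ip_commute)
    ultimately show ?thesis
      by (simp add: e_eq ip_app_left weighted_ip_commute[of _ _ g f] weighted_ip_add_left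
          weighted_ip_scale_left weighted_ip_add_right weighted_ip_scale_right kernel_op_add
          kernel_op_scale power2_eq_square algebra_simps)
  qed
  then have "2 * (e * ip f g - ip (app f) g) = 0" by (rule linear_coeff_eq_0_if_quadratic_nonneg)
  then show ?thesis by simp
qed

lemma eigenfunction_orthogonal_to_invariant_family:
  assumes "finite \<Phi>" and "card \<Phi> < card \<Omega>"
    and invariant: "\<And>g h. h \<in> \<Phi> \<Longrightarrow> ip g h = 0 \<Longrightarrow> ip (app g) h = 0"
  obtains f e where "f \<in> orthogonal_sphere \<Phi>" "\<And>x. x \<in> \<Omega> \<Longrightarrow> app f x = e * f x"
proof -
  obtain f where f_sphere: "f \<in> orthogonal_sphere \<Phi>"
    and max: "\<And>g. (\<And>h. h \<in> \<Phi> \<Longrightarrow> ip g h = 0) \<Longrightarrow> ip g (app g) \<le> ip f (app f) * ip g g"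
    using Rayleigh_maximiser_exists[OF assms(1,2)] by blast
  define e where "e = ip f (app f)"
  define g where "g = (\<lambda>x. app f x - e * f x)"
  have "ip g h = 0" if "h \<in> \<Phi>" for h
    using f_sphere that invariant[OF that, of f]
    by (simp add: g_def orthogonal_sphere_def weighted_ip_diff_left weighted_ip_scale_left)
  then have "ip (app f) g = e * ip f g"
    using f_sphere max unfolding e_def by (intro Rayleigh_maximiser_stationary) auto
  then have "ip g g = 0"
    by (subst (1) g_def) (simp add: weighted_ip_diff_left weighted_ip_scale_left)
  then have "app f x = e * f x" if "x \<in> \<Omega>" for x using ip_eq_0D[of g x] that by (simp add: g_def)
  with f_sphere that show thesis by blast
qed

definition orthonormal_eigenfamily :: "nat \<Rightarrow> (nat \<Rightarrow> 'a \<Rightarrow> real) \<Rightarrow> (nat \<Rightarrow> real) \<Rightarrow> bool" where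
  "orthonormal_eigenfamily m \<phi> l \<longleftrightarrow>
     (\<forall>i<m. \<forall>j<m. ip (\<phi> i) (\<phi> j) = (if i = j then 1 else 0)) \<and>
     (\<forall>i<m. \<forall>x\<in>\<Omega>. app (\<phi> i) x = l i * \<phi> i x)"

lemma orthonormal_eigenfamily_extend:
  assumes eigenfamily: "orthonormal_eigenfamily m \<phi> l" and "m < card \<Omega>"
  shows "\<exists>f e. orthonormal_eigenfamily (Suc m) (\<phi>(m := f)) (l(m := e))"
proof -
  let ?\<Phi> = "\<phi> ` {..<m}"
  have "card ?\<Phi> < card \<Omega>" using card_image_le[of "{..<m}" \<phi>] assms(2) by simp
  moreover have "ip (app g) h = 0" if h_mem: "h \<in> ?\<Phi>" and orthogonal: "ip g h = 0" for g h
  proof -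
    obtain i where i_index: "i < m" "h = \<phi> i" using h_mem by auto
    have "ip (app g) h = ip g (\<lambda>x. l i * h x)"
      unfolding ip_app_left using eigenfamily i_index
      by (intro weighted_ip_cong) (auto simp: orthonormal_eigenfamily_def)
    then show ?thesis using orthogonal by (simp add: weighted_ip_scale_right)
  qed
  ultimately obtain f e where f_sphere: "f \<in> orthogonal_sphere ?\<Phi>"
    and eigen: "\<And>x. x \<in> \<Omega> \<Longrightarrow> app f x = e * f x"
    using eigenfunction_orthogonal_to_invariant_family[of ?\<Phi>] by blast
  have "ip (\<phi> i) f = 0" if "i < m" for i
    using f_sphere that by (subst weighted_ip_commute) (simp add: orthogonal_sphere_def)
  then have "orthonormal_eigenfamily (Suc m) (\<phi>(m := f)) (l(m := e))"
    using eigenfamily f_sphere eigen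
    by (auto simp: orthonormal_eigenfamily_def orthogonal_sphere_def less_Suc_eq)
  then show ?thesis by blast
qed

lemma orthonormal_eigenbasis_exists: "\<exists>\<phi> l. orthonormal_eigenfamily (card \<Omega>) \<phi> l"
proof -
  have "\<exists>\<phi> l. orthonormal_eigenfamily m \<phi> l" if "m \<le> card \<Omega>" for m
    using that
  proof (induction m)
    case 0
    then show ?case by (simp add: orthonormal_eigenfamily_def)
  next
    case (Suc m)
    then show ?case using orthonormal_eigenfamily_extend by (metis Suc_le_eq less_imp_le)
  qed
  then show ?thesis by blast
qed

lemma eigenvalues_eq_eigenbasis:
  assumes "orthonormal_eigenfamily (card \<Omega>) \<phi> l"
  shows "eigenvalues \<Omega> K = mset (map l [0..<card \<Omega>])"
proof (rule eigenvalues_eq_if_biorthogonal_eigenfamily[OF finite_space])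
  fix i j assume "i < card \<Omega>" "j < card \<Omega>"
  moreover have "(\<Sum>x\<in>\<Omega>. (w x * \<phi> i x) * \<phi> j x) = ip (\<phi> i) (\<phi> j)"
    by (simp add: weighted_ip_def)
  ultimately show "(\<Sum>x\<in>\<Omega>. (w x * \<phi> i x) * \<phi> j x) = (if i = j then 1 else 0)"
    using assms by (simp add: orthonormal_eigenfamily_def)
qed (use assms in \<open>simp add: orthonormal_eigenfamily_def\<close>)

lemma size_eigenvalues: "size (eigenvalues \<Omega> K) = card \<Omega>"
  using orthonormal_eigenbasis_exists eigenvalues_eq_eigenbasis by fastforce

lemma size_filter_eigenvalues:
  assumes "orthonormal_eigenfamily (card \<Omega>) \<phi> l"
  shows "size {#e \<in># eigenvalues \<Omega> K. P e#} = card {i. i < card \<Omega> \<and> P (l i)}"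
proof -
  let ?is = "filter (\<lambda>i. P (l i)) [0..<card \<Omega>]"
  have "size {#e \<in># eigenvalues \<Omega> K. P e#} = length ?is"
    unfolding eigenvalues_eq_eigenbasis[OF assms] mset_filter[symmetric]
    by (simp only: filter_map size_mset length_map o_def)
  also have "\<dots> = card (set ?is)" by (rule distinct_card[symmetric]) simp
  also have "set ?is = {i. i < card \<Omega> \<and> P (l i)}" by auto
  finally show ?thesis .
qed

lemma orthonormal_eigenfamily_combination:
  fixes c :: "nat \<Rightarrow> real"
  assumes eigenfamily: "orthonormal_eigenfamily m \<phi> l" and I_subset: "I \<subseteq> {..<m}"
  defines "f \<equiv> \<lambda>x. \<Sum>i\<in>I. c i * \<phi> i x"
  shows "ip f f = (\<Sum>i\<in>I. (c i)\<^sup>2)" and "ip f (app f) = (\<Sum>i\<in>I. l i * (c i)\<^sup>2)"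
proof -
  have expand: "ip f (\<lambda>x. \<Sum>i\<in>I. b i * \<phi> i x) = (\<Sum>i\<in>I. c i * b i)" for b
  proof -
    have "ip f (\<lambda>x. \<Sum>j\<in>I. b j * \<phi> j x) = (\<Sum>i\<in>I. \<Sum>j\<in>I. c i * b j * ip (\<phi> i) (\<phi> j))"
      by (simp add: f_def weighted_ip_sum_left weighted_ip_sum_right weighted_ip_scale_left
          weighted_ip_scale_right sum_distrib_left mult_ac)
    also have "\<dots> = (\<Sum>i\<in>I. \<Sum>j\<in>I. if i = j then c i * b j else 0)"
      using eigenfamily I_subset
      by (intro sum.cong refl) (auto simp: orthonormal_eigenfamily_def subset_iff)
    finally show ?thesis using finite_subset[OF I_subset] by simp
  qed
  show "ip f f = (\<Sum>i\<in>I. (c i)\<^sup>2)" using expand[of c] by (simp add: f_def power2_eq_square)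
  have "app f x = (\<Sum>i\<in>I. (l i * c i) * \<phi> i x)" if "x \<in> \<Omega>" for x
    using eigenfamily I_subset that
    by (auto simp: f_def kernel_op_sum kernel_op_scale orthonormal_eigenfamily_def intro!: sum.cong)
  then have "ip f (app f) = ip f (\<lambda>x. \<Sum>i\<in>I. (l i * c i) * \<phi> i x)" by (intro weighted_ip_cong) auto
  then show "ip f (app f) = (\<Sum>i\<in>I. l i * (c i)\<^sup>2)"
    unfolding expand by (simp add: power2_eq_square mult_ac)
qed

lemma card_eigenvalues_gt_le_codimension:
  assumes "finite J"
    and bound: "\<And>f. (\<And>j. j \<in> J \<Longrightarrow> ip f (\<psi> j) = 0) \<Longrightarrow> ip f (app f) \<le> a * ip f f"
  shows "size {#e \<in># eigenvalues \<Omega> K. e > a#} \<le> card J"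
proof (rule ccontr)
  obtain \<phi> l where eigenfamily: "orthonormal_eigenfamily (card \<Omega>) \<phi> l"
    using orthonormal_eigenbasis_exists by blast
  define I where "I = {i. i < card \<Omega> \<and> l i > a}"
  have I_subset: "finite I" "I \<subseteq> {..<card \<Omega>}" by (auto simp: I_def)
  assume "\<not> ?thesis"
  then have "card J < card I" by (simp add: size_filter_eigenvalues[OF eigenfamily] I_def)
  then obtain c where c_solution: "\<exists>i\<in>I. c i \<noteq> 0" "\<forall>j\<in>J. (\<Sum>i\<in>I. ip (\<phi> i) (\<psi> j) * c i) = 0"
    using exists_nonzero_solution[OF assms(1) I_subset(1), of "\<lambda>j i. ip (\<phi> i) (\<psi> j)"] by blast
  define f where "f = (\<lambda>x. \<Sum>i\<in>I. c i * \<phi> i x)"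
  note norms = orthonormal_eigenfamily_combination[OF eigenfamily I_subset(2), of c, folded f_def]
  have "ip f (\<psi> j) = 0" if "j \<in> J" for j
    using c_solution(2) that
    by (simp add: f_def weighted_ip_sum_left weighted_ip_scale_left mult.commute)
  then have "ip f (app f) \<le> a * ip f f" by (rule bound)
  moreover have "(\<Sum>i\<in>I. a * (c i)\<^sup>2) < (\<Sum>i\<in>I. l i * (c i)\<^sup>2)"
    using c_solution(1)
    by (intro sum_strict_mono_ex1 I_subset) (auto simp: I_def intro!: mult_right_mono)
  ultimately show False by (simp add: norms sum_distrib_left)
qed

lemma spectral_gap_ge:
  assumes "size {#e \<in># eigenvalues \<Omega> K. e > a#} \<le> 1" and "0 \<le> a"
  shows "1 - a \<le> spectral_gap \<Omega> K"
  using second_largest_le[OF assms(1)] assms(2) by (simp add: spectral_gap_def size_eigenvalues)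

end

section \<open>Convergence of contracting chains\<close>

lemma kernel_power_eq_funpow: "kernel_power \<Omega> K t x y = (kernel_op \<Omega> K ^^ t) (indicator {y}) x"
  by (induction t arbitrary: x) (auto simp: kernel_op_def indicator_def)

lemma mixing_time_le_if_at_floor:
  assumes "0 \<le> T" and "D \<Omega> (kernel_power \<Omega> K (nat \<lfloor>T\<rfloor>) x) (stationary_dist \<Omega> K) \<le> \<epsilon>"
  shows "ereal_of_enat (mixing_time D \<Omega> K x \<epsilon>) \<le> ereal T"
proof -
  have "mixing_time D \<Omega> K x \<epsilon> \<le> enat (nat \<lfloor>T\<rfloor>)"
    unfolding mixing_time_def using assms(2) by (intro Inf_lower) auto
  then have "ereal_of_enat (mixing_time D \<Omega> K x \<epsilon>) \<le> ereal_of_enat (enat (nat \<lfloor>T\<rfloor>))"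
    by (simp only: ereal_of_enat_le_iff)
  also have "\<dots> \<le> ereal T" using assms(1) by simp
  finally show ?thesis .
qed

lemma power_at_floor_le:
  fixes r a :: real
  assumes r_ge_1: "1 \<le> r" and a_bounds: "0 < a" "a \<le> 1"
  shows "(1 - 1 / r) ^ nat \<lfloor>r * ln (1 / a)\<rfloor> \<le> exp (1 / r) * a"
proof -
  define t where "t = nat \<lfloor>r * ln (1 / a)\<rfloor>"
  have "0 \<le> r * ln (1 / a)" using r_ge_1 a_bounds by simp
  then have t_ge: "r * ln (1 / a) - 1 \<le> real t" by (simp add: t_def)
  have "(1 - 1 / r) ^ t \<le> exp (- 1 / r) ^ t"
    using exp_ge_add_one_self[of "- 1 / r"] r_ge_1 by (intro power_mono) simp_all
  also have "\<dots> = exp (- (real t / r))" by (simp flip: exp_of_nat_mult)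
  also have "\<dots> \<le> exp (1 / r - ln (1 / a))" using t_ge r_ge_1 by (simp add: field_simps)
  also have "\<dots> = exp (1 / r) * a" using a_bounds by (simp add: ln_div exp_add)
  finally show ?thesis by (simp add: t_def)
qed

lemma mult_sqrt_inverse_minus_one_le:
  fixes m :: real
  assumes "0 < m" "m \<le> 1"
  shows "m * sqrt (1 / m - 1) \<le> 1 / 2"
proof -
  have "m * sqrt (1 / m - 1) = sqrt (m\<^sup>2 * (1 / m - 1))" using assms by (simp add: real_sqrt_mult)
  also have "m\<^sup>2 * (1 / m - 1) = m * (1 - m)"
    using assms by (simp add: field_simps power2_eq_square)
  also have "sqrt (m * (1 - m)) \<le> (m + (1 - m)) / 2"
    using assms by (intro arith_geo_mean_sqrt) simp_all
  finally show ?thesis by simp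
qed

context reversible_kernel
begin

lemma ip_funpow_app_left: "ip ((app ^^ t) f) g = ip f ((app ^^ t) g)"
proof (induction t arbitrary: g)
  case (Suc t)
  have "ip ((app ^^ Suc t) f) g = ip ((app ^^ t) f) (app g)" by (simp add: ip_app_left)
  also have "\<dots> = ip f ((app ^^ Suc t) g)" unfolding Suc by (simp add: funpow_swap1)
  finally show ?case .
qed simp

lemma kernel_power_reversible:
  assumes "x \<in> \<Omega>" "y \<in> \<Omega>"
  shows "w x * kernel_power \<Omega> K t x y = w y * kernel_power \<Omega> K t y x"
proof -
  have "w x * kernel_power \<Omega> K t x y = ip ((app ^^ t) (indicator {y})) (indicator {x})"
    using assms finite_space by (simp add: weighted_ip_indicator kernel_power_eq_funpow)
  also have "\<dots> = ip (indicator {y}) ((app ^^ t) (indicator {x}))" by (rule ip_funpow_app_left)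
  also have "\<dots> = ip ((app ^^ t) (indicator {x})) (indicator {y})" by (rule weighted_ip_commute)
  also have "\<dots> = w y * kernel_power \<Omega> K t y x"
    using assms finite_space by (simp add: weighted_ip_indicator kernel_power_eq_funpow)
  finally show ?thesis .
qed

end

locale reversible_chain = reversible_kernel +
  assumes weight_sum: "sum w \<Omega> = 1"
    and app_one: "\<And>x. x \<in> \<Omega> \<Longrightarrow> app (\<lambda>_. 1) x = 1"
begin

lemma weight_le_1: "x \<in> \<Omega> \<Longrightarrow> w x \<le> 1"
  using member_le_sum[of x \<Omega> w] finite_space weight_pos weight_sum by (simp add: less_imp_le)

lemma mult_weight_bounds:
  assumes "x \<in> \<Omega>" "0 < \<epsilon>" "\<epsilon> \<le> 1"
  shows "0 < \<epsilon> * w x" and "\<epsilon> * w x \<le> 1"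
  using assms weight_pos[of x] weight_le_1[of x] by (auto intro: mult_le_one)

lemma ip_app_one: "ip (app f) (\<lambda>_. 1) = ip f (\<lambda>_. 1)"
  unfolding ip_app_left by (rule weighted_ip_cong) (auto simp: app_one)

lemma sum_weight_kernel: "y \<in> \<Omega> \<Longrightarrow> (\<Sum>x\<in>\<Omega>. w x * K x y) = w y"
  using app_one[of y] by (simp add: kernel_op_def reversible[of _ y] flip: sum_distrib_left)

lemma is_stationary_weight: "is_stationary \<Omega> K (\<lambda>x. if x \<in> \<Omega> then w x else 0)"
  using weight_sum weight_pos by (auto simp: is_stationary_def less_imp_le sum_weight_kernel)

lemma app_stationary_density:
  assumes stationary: "is_stationary \<Omega> K p" and x_mem: "x \<in> \<Omega>"
  shows "app (\<lambda>y. p y / w y) x = p x / w x"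
proof -
  have "w x * app (\<lambda>y. p y / w y) x = (\<Sum>y\<in>\<Omega>. (w y * K y x) * (p y / w y))"
    using x_mem by (simp add: kernel_op_def sum_distrib_left reversible flip: mult.assoc)
  also have "\<dots> = (\<Sum>y\<in>\<Omega>. p y * K y x)"
    using weight_pos by (intro sum.cong refl) (simp add: less_imp_neq[symmetric])
  also have "\<dots> = p x" using stationary x_mem by (simp add: is_stationary_def)
  finally show ?thesis using weight_pos[OF x_mem] by (simp add: field_simps)
qed

lemma sum_weighted_abs_le_norm: "(\<Sum>x\<in>\<Omega>. \<bar>w x * f x\<bar>) \<le> sqrt (ip f f)"
proof (rule real_le_rsqrt)
  have "(\<Sum>x\<in>\<Omega>. \<bar>w x * f x\<bar>) = ip (\<lambda>x. \<bar>f x\<bar>) (\<lambda>_. 1)"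
    by (simp add: weighted_ip_def abs_mult weight_pos less_imp_le)
  also have "(\<dots>)\<^sup>2 \<le> ip (\<lambda>x. \<bar>f x\<bar>) (\<lambda>x. \<bar>f x\<bar>) * ip (\<lambda>_. 1) (\<lambda>_. 1)"
    by (simp add: weighted_ip_Cauchy_Schwarz weight_pos less_imp_le)
  also have "\<dots> = ip f f" by (simp add: weighted_ip_def weight_sum mult.assoc)
  finally show "(\<Sum>x\<in>\<Omega>. \<bar>w x * f x\<bar>)\<^sup>2 \<le> ip f f" .
qed

definition centred_density :: "'a \<Rightarrow> 'a \<Rightarrow> real" where
  "centred_density x y = indicator {x} y / w x - 1"

lemma ip_centred_density:
  assumes "x \<in> \<Omega>"
  shows "ip (centred_density x) f = f x - ip (\<lambda>_. 1) f"
proof -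
  have "ip (centred_density x) f = ip f (indicator {x}) / w x - ip (\<lambda>_. 1) f"
    by (simp add: weighted_ip_def centred_density_def algebra_simps sum_subtractf sum_divide_distrib)
  then show ?thesis using assms finite_space weight_pos[OF assms] by (simp add: weighted_ip_indicator)
qed

lemma centred_density_mean: "x \<in> \<Omega> \<Longrightarrow> ip (centred_density x) (\<lambda>_. 1) = 0"
  using weight_sum by (simp add: ip_centred_density) (simp add: weighted_ip_def)

lemma centred_density_norm:
  assumes "x \<in> \<Omega>"
  shows "ip (centred_density x) (centred_density x) = 1 / w x - 1"
proof -
  have "ip (\<lambda>_. 1) (centred_density x) = 0"
    using centred_density_mean[OF assms] by (subst weighted_ip_commute)
  then show ?thesis using assms by (simp add: ip_centred_density) (simp add: centred_density_def)
qed

lemma funpow_app_centred_density: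
  assumes "x \<in> \<Omega>" "y \<in> \<Omega>"
  shows "(app ^^ t) (centred_density x) y = kernel_power \<Omega> K t y x / w x - 1"
  using assms(2)
proof (induction t arbitrary: y)
  case 0
  then show ?case by (simp add: centred_density_def indicator_def)
next
  case (Suc t)
  have "(app ^^ Suc t) (centred_density x) y = app (\<lambda>y. kernel_power \<Omega> K t y x / w x - 1) y"
    using Suc.IH by (simp cong: kernel_op_cong)
  also have "\<dots> = (\<Sum>z\<in>\<Omega>. K y z * kernel_power \<Omega> K t z x) / w x - app (\<lambda>_. 1) y"
    by (simp add: kernel_op_def right_diff_distrib sum_subtractf sum_divide_distrib)
  finally show ?case using Suc.prems by (simp add: app_one)
qed

lemma weight_mult_funpow_app_centred_density:
  assumes "x \<in> \<Omega>" "y \<in> \<Omega>"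
  shows "w y * (app ^^ t) (centred_density x) y = kernel_power \<Omega> K t x y - w y"
proof -
  have "w y * (app ^^ t) (centred_density x) y = (w y * kernel_power \<Omega> K t y x) / w x - w y"
    using assms by (simp add: funpow_app_centred_density right_diff_distrib)
  then show ?thesis
    using kernel_power_reversible[OF assms(2,1), of t] weight_pos[OF assms(1)] by simp
qed

end

locale contracting_chain = reversible_chain +
  fixes c :: real
  assumes contraction: "\<And>f. ip f (\<lambda>_. 1) = 0 \<Longrightarrow> ip (app f) (app f) \<le> c\<^sup>2 * ip f f"
    and c_nonneg: "0 \<le> c" and c_less: "c < 1"
begin

lemma mean_zero_fixed_eq_0:
  assumes mean: "ip f (\<lambda>_. 1) = 0" and fixed: "\<And>x. x \<in> \<Omega> \<Longrightarrow> app f x = f x" and "x \<in> \<Omega>"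
  shows "f x = 0"
proof -
  have "ip f f = ip (app f) (app f)" using fixed by (intro weighted_ip_cong) auto
  then have "ip f f \<le> c\<^sup>2 * ip f f" using contraction[OF mean] by simp
  moreover have "c\<^sup>2 < 1" using c_nonneg c_less by (simp add: power_less_one_iff)
  ultimately have "ip f f = 0"
    using ip_nonneg[of f] mult_less_cancel_right2[of "c\<^sup>2" "ip f f"] by linarith
  then show ?thesis using assms(3) by (rule ip_eq_0D)
qed

lemma stationary_dist_eq: "stationary_dist \<Omega> K = (\<lambda>x. if x \<in> \<Omega> then w x else 0)"
  unfolding stationary_dist_def
proof (rule the_equality, rule is_stationary_weight)
  fix p assume stationary: "is_stationary \<Omega> K p"
  define f where "f x = p x / w x - 1" for x
  have weight_mult_f: "w x * f x = p x - w x" if "x \<in> \<Omega>" for x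
    using weight_pos[OF that] by (simp add: f_def field_simps)
  have "ip f (\<lambda>_. 1) = sum p \<Omega> - sum w \<Omega>"
    by (simp add: weighted_ip_def weight_mult_f sum_subtractf)
  then have "ip f (\<lambda>_. 1) = 0" using stationary weight_sum by (simp add: is_stationary_def)
  moreover have "app f x = f x" if "x \<in> \<Omega>" for x
  proof -
    have "app f x = app (\<lambda>y. p y / w y) x - app (\<lambda>_. 1) x"
      by (simp add: kernel_op_def f_def right_diff_distrib sum_subtractf)
    then show ?thesis using that stationary by (simp add: app_stationary_density app_one f_def)
  qed
  ultimately have "p x = w x" if "x \<in> \<Omega>" for x
    using mean_zero_fixed_eq_0[of f x] weight_mult_f[OF that] that by simp
  then show "p = (\<lambda>x. if x \<in> \<Omega> then w x else 0)"
    using stationary by (auto simp: is_stationary_def fun_eq_iff)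
qed

lemma funpow_contraction:
  assumes "ip f (\<lambda>_. 1) = 0"
  shows "ip ((app ^^ t) f) ((app ^^ t) f) \<le> (c ^ t)\<^sup>2 * ip f f"
proof (induction t)
  case (Suc t)
  have "ip ((app ^^ t) f) (\<lambda>_. 1) = 0" using assms by (induction t) (simp_all add: ip_app_one)
  then have "ip ((app ^^ Suc t) f) ((app ^^ Suc t) f) \<le> c\<^sup>2 * ip ((app ^^ t) f) ((app ^^ t) f)"
    using contraction by simp
  also have "\<dots> \<le> c\<^sup>2 * ((c ^ t)\<^sup>2 * ip f f)" by (intro mult_left_mono Suc) simp
  finally show ?case by (simp add: power_mult_distrib mult_ac)
qed simp

lemma l1_dist_kernel_power_le:
  assumes x_mem: "x \<in> \<Omega>"
  shows "l1_dist \<Omega> (kernel_power \<Omega> K t x) (stationary_dist \<Omega> K) \<le> c ^ t * sqrt (1 / w x - 1)"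
proof -
  let ?g = "(app ^^ t) (centred_density x)"
  have "l1_dist \<Omega> (kernel_power \<Omega> K t x) (stationary_dist \<Omega> K) = (\<Sum>y\<in>\<Omega>. \<bar>w y * ?g y\<bar>)"
    using x_mem by (simp add: l1_dist_def stationary_dist_eq weight_mult_funpow_app_centred_density)
  also have "\<dots> \<le> sqrt (ip ?g ?g)" by (rule sum_weighted_abs_le_norm)
  also have "\<dots> \<le> sqrt ((c ^ t)\<^sup>2 * (1 / w x - 1))"
    using funpow_contraction[OF centred_density_mean[OF x_mem], of t]
    by (simp add: centred_density_norm x_mem)
  finally show ?thesis using c_nonneg by (simp add: real_sqrt_mult)
qed

lemma l1_dist_at_floor_le:
  assumes x_mem: "x \<in> \<Omega>" and eps_bounds: "0 < \<epsilon>" "\<epsilon> < 1" and rate: "1 \<le> r" "c \<le> 1 - 1 / r"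
  shows "l1_dist \<Omega> (kernel_power \<Omega> K (nat \<lfloor>r * ln (1 / (\<epsilon> * w x))\<rfloor>) x) (stationary_dist \<Omega> K)
    \<le> exp (1 / r) * \<epsilon> / 2"
proof -
  have weight_bounds: "0 < w x" "w x \<le> 1" using x_mem by (rule weight_pos, rule weight_le_1)
  let ?t = "nat \<lfloor>r * ln (1 / (\<epsilon> * w x))\<rfloor>"
  have "(1 - 1 / r) ^ ?t \<le> exp (1 / r) * (\<epsilon> * w x)"
    using x_mem eps_bounds rate by (intro power_at_floor_le mult_weight_bounds) auto
  then have power_le: "c ^ ?t \<le> exp (1 / r) * (\<epsilon> * w x)"
    using power_mono[OF rate(2) c_nonneg] order_trans by blast
  have "l1_dist \<Omega> (kernel_power \<Omega> K ?t x) (stationary_dist \<Omega> K) \<le> c ^ ?t * sqrt (1 / w x - 1)"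
    by (rule l1_dist_kernel_power_le[OF x_mem])
  also have "\<dots> \<le> exp (1 / r) * (\<epsilon> * w x) * sqrt (1 / w x - 1)"
    using weight_bounds by (intro mult_right_mono power_le) simp
  also have "\<dots> = exp (1 / r) * \<epsilon> * (w x * sqrt (1 / w x - 1))" by simp
  also have "\<dots> \<le> exp (1 / r) * \<epsilon> * (1 / 2)"
    using eps_bounds weight_bounds by (intro mult_left_mono mult_sqrt_inverse_minus_one_le) auto
  finally show ?thesis by simp
qed

lemma log_time_nonneg:
  assumes "x \<in> \<Omega>" "0 < \<epsilon>" "\<epsilon> < 1" "1 \<le> r"
  shows "0 \<le> r * ln (1 / (\<epsilon> * w x))"
  using mult_weight_bounds[of x \<epsilon>] assms by simp

lemma tv_mixing_time_le:
  assumes "x \<in> \<Omega>" "0 < \<epsilon>" "\<epsilon> < 1" and rate: "1 \<le> r" "c \<le> 1 - 1 / r"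
  shows "ereal_of_enat (mixing_time tv_dist \<Omega> K x \<epsilon>) \<le> ereal (r * ln (1 / (\<epsilon> * w x)))"
proof (intro mixing_time_le_if_at_floor log_time_nonneg)
  have "exp (1 / r) \<le> exp 1" using rate by simp
  also have "exp 1 \<le> (3 :: real)" by (rule exp_le)
  finally have "exp (1 / r) * \<epsilon> \<le> 3 * \<epsilon>" using assms by (intro mult_right_mono) auto
  then show "tv_dist \<Omega> (kernel_power \<Omega> K (nat \<lfloor>r * ln (1 / (\<epsilon> * w x))\<rfloor>) x) (stationary_dist \<Omega> K) \<le> \<epsilon>"
    unfolding tv_dist_def using l1_dist_at_floor_le[OF assms] \<open>0 < \<epsilon>\<close> by linarith
qed (use assms in auto)

lemma l1_mixing_time_le:
  assumes "x \<in> \<Omega>" "0 < \<epsilon>" "\<epsilon> < 1" and rate: "2 \<le> r" "c \<le> 1 - 1 / r"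
  shows "ereal_of_enat (mixing_time l1_dist \<Omega> K x \<epsilon>) \<le> ereal (r * ln (1 / (\<epsilon> * w x)))"
proof (intro mixing_time_le_if_at_floor log_time_nonneg)
  have "(exp (1 / r))\<^sup>2 \<le> exp 1" using rate by (simp add: field_simps flip: exp_double)
  also have "exp 1 \<le> (2 :: real)\<^sup>2" using exp_le by simp
  finally have "exp (1 / r) \<le> 2" by (rule power2_le_imp_le) simp
  then have "exp (1 / r) * \<epsilon> \<le> 2 * \<epsilon>" using assms by (intro mult_right_mono) auto
  then show "l1_dist \<Omega> (kernel_power \<Omega> K (nat \<lfloor>r * ln (1 / (\<epsilon> * w x))\<rfloor>) x) (stationary_dist \<Omega> K) \<le> \<epsilon>"
    using l1_dist_at_floor_le[of x \<epsilon> r] assms by linarith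
qed (use assms in auto)

end

section \<open>Derivatives of the generating polynomial\<close>

definition link :: "'a set \<Rightarrow> ('a set \<Rightarrow> real) \<Rightarrow> 'a set \<Rightarrow> real" where
  "link T \<mu> S = (if S \<inter> T = {} then \<mu> (S \<union> T) else 0)"

definition marginal :: "nat \<Rightarrow> (nat set \<Rightarrow> real) \<Rightarrow> nat set \<Rightarrow> real" where
  "marginal n \<mu> T = sum \<mu> {T..{1..n}}"

lemma link_empty: "link {} \<mu> = \<mu>"
  by (simp add: link_def fun_eq_iff)

lemma link_zero: "link T (\<lambda>_. 0) = (\<lambda>_. 0)"
  by (simp add: link_def fun_eq_iff)

lemma link_singleton_link:
  "link {i} (link T \<mu>) = (if i \<in> T then \<lambda>_. 0 else link (insert i T) \<mu>)"
  by (auto simp: link_def fun_eq_iff)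

lemma gen_poly_zero: "gen_poly n (\<lambda>_. 0) = (\<lambda>_. 0)"
  by (simp add: gen_poly_def fun_eq_iff)

lemma gen_poly_link_one:
  assumes "T \<subseteq> {1..n}"
  shows "gen_poly n (link T \<mu>) (\<lambda>_. 1) = marginal n \<mu> T"
proof -
  have "gen_poly n (link T \<mu>) (\<lambda>_. 1) = (\<Sum>S\<in>{S \<in> Pow {1..n}. S \<inter> T = {}}. \<mu> (S \<union> T))"
    by (simp add: gen_poly_def link_def sum.inter_filter del: Pow_iff)
  also have "\<dots> = marginal n \<mu> T"
    unfolding marginal_def using assms
    by (intro sum.reindex_bij_witness[of _ "\<lambda>S. S - T" "\<lambda>S. S \<union> T"]) (auto simp: Un_absorb2)
  finally show ?thesis .
qed

lemma sum_Pow_insert: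
  assumes "finite A" "i \<notin> A"
  shows "sum f (Pow (insert i A)) = (\<Sum>S\<in>Pow A. f S + f (insert i S))"
proof -
  have "inj_on (insert i) (Pow A)"
    using assms(2) by (intro inj_onI) (metis Pow_iff insert_ident subsetD)
  moreover have "Pow A \<inter> insert i ` Pow A = {}" using assms(2) by auto
  ultimately show ?thesis
    using assms(1) by (simp add: Pow_insert sum.union_disjoint sum.reindex sum.distrib)
qed

lemma gen_poly_upd:
  assumes i_mem: "i \<in> {1..n}"
  shows "gen_poly n \<nu> (x(i := t)) = gen_poly n \<nu> (x(i := 0)) + t * gen_poly n (link {i} \<nu>) x"
proof -
  let ?N = "{1..n} - {i}"
  have sum_Pow_split: "sum f (Pow {1..n}) = (\<Sum>S\<in>Pow ?N. f S + f (insert i S))" for f :: "nat set \<Rightarrow> real"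
    using sum_Pow_insert[of ?N i f] i_mem by (simp add: insert_absorb)
  have prod_upd: "(\<Prod>l\<in>S. (x(i := s)) l) = (\<Prod>l\<in>S. x l)" if "S \<in> Pow ?N" for S s
    using that by (intro prod.cong) auto
  have prod_insert_upd: "(\<Prod>l\<in>insert i S. (x(i := s)) l) = s * (\<Prod>l\<in>S. x l)" if "S \<in> Pow ?N" for S s
    using that finite_subset[of S ?N] prod_upd[OF that] by (subst prod.insert) auto
  have "gen_poly n \<nu> (x(i := s))
      = (\<Sum>S\<in>Pow ?N. \<nu> S * (\<Prod>l\<in>S. x l)) + s * (\<Sum>S\<in>Pow ?N. \<nu> (insert i S) * (\<Prod>l\<in>S. x l))" for s
    unfolding gen_poly_def sum_Pow_split sum_distrib_left sum.distrib[symmetric]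
    by (intro sum.cong refl) (simp only: prod_upd prod_insert_upd mult.left_commute)
  moreover have "gen_poly n (link {i} \<nu>) x = (\<Sum>S\<in>Pow ?N. \<nu> (insert i S) * (\<Prod>l\<in>S. x l))"
    unfolding gen_poly_def sum_Pow_split by (intro sum.cong refl) (auto simp: link_def)
  ultimately show ?thesis by simp
qed

lemma has_real_derivative_gen_poly:
  assumes "i \<in> {1..n}"
  shows "((\<lambda>t. gen_poly n \<nu> (x(i := t))) has_real_derivative gen_poly n (link {i} \<nu>) x) (at s)"
  by (subst gen_poly_upd[OF assms]) (auto intro!: derivative_eq_intros)

lemma partial_gen_poly: "i \<in> {1..n} \<Longrightarrow> partial i (gen_poly n \<nu>) = gen_poly n (link {i} \<nu>)"
  by (auto simp: partial_def fun_eq_iff intro!: DERIV_imp_deriv has_real_derivative_gen_poly)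

lemma foldr_partial_gen_poly:
  "distinct is \<Longrightarrow> set is \<subseteq> {1..n} \<Longrightarrow>
    foldr partial is (gen_poly n \<mu>) = gen_poly n (link (set is) \<mu>)"
  by (induction "is") (simp_all add: link_empty partial_gen_poly link_singleton_link)

lemma hessian_ln:
  assumes pos: "0 < p x"
    and deriv_i: "((\<lambda>t. p (x(i := t))) has_real_derivative partial i p x) (at (x i))"
    and deriv_j: "\<And>y. ((\<lambda>t. p (y(j := t))) has_real_derivative partial j p y) (at (y j))"
    and deriv_ij: "((\<lambda>t. partial j p (x(i := t))) has_real_derivative hessian p x i j) (at (x i))"
  shows "hessian (\<lambda>x. ln (p x)) x i j
    = (p x * hessian p x i j - partial i p x * partial j p x) / (p x)\<^sup>2"
proof -
  have partial_ln: "partial j (\<lambda>x. ln (p x)) y = partial j p y / p y" if "0 < p y" for y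
    unfolding partial_def[of j "\<lambda>x. ln (p x)"] using that
    by (auto intro!: DERIV_imp_deriv derivative_eq_intros deriv_j)
  have "((\<lambda>t. p (x(i := t))) \<longlongrightarrow> p x) (nhds (x i))"
    using DERIV_isCont[OF deriv_i] tendsto_at_iff_tendsto_nhds[of "\<lambda>t. p (x(i := t))" "x i"]
    by (simp add: isCont_def)
  then have "\<forall>\<^sub>F t in nhds (x i). 0 < p (x(i := t))" using pos by (rule order_tendstoD)
  then have partial_ln_near: "\<forall>\<^sub>F t in nhds (x i).
      partial j p (x(i := t)) / p (x(i := t)) = partial j (\<lambda>x. ln (p x)) (x(i := t))"
    by (rule eventually_mono) (simp add: partial_ln)
  have "((\<lambda>t. partial j p (x(i := t)) / p (x(i := t))) has_real_derivative
      (hessian p x i j * p x - partial j p x * partial i p x) / (p x * p x)) (at (x i))"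
    using DERIV_divide[OF deriv_ij deriv_i] pos by simp
  then have "((\<lambda>t. partial j (\<lambda>x. ln (p x)) (x(i := t))) has_real_derivative
      (hessian p x i j * p x - partial j p x * partial i p x) / (p x * p x)) (at (x i))"
    by (rule iffD1[OF DERIV_cong_ev[OF refl partial_ln_near refl]])
  then show ?thesis
    unfolding hessian_def[of "\<lambda>x. ln (p x)"]
    by (subst partial_def) (simp add: DERIV_imp_deriv power2_eq_square mult.commute)
qed

lemma log_concave_gen_polyD:
  fixes v :: "nat \<Rightarrow> real"
  assumes log_concave: "log_concave_at_one n (gen_poly n \<nu>)" and pos: "0 < gen_poly n \<nu> (\<lambda>_. 1)"
  shows "gen_poly n \<nu> (\<lambda>_. 1)
      * (\<Sum>i=1..n. \<Sum>j=1..n. v i * gen_poly n (link {i} (link {j} \<nu>)) (\<lambda>_. 1) * v j)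
    \<le> (\<Sum>i=1..n. v i * gen_poly n (link {i} \<nu>) (\<lambda>_. 1))\<^sup>2"
proof -
  let ?e = "\<lambda>_. 1 :: real"
  let ?p = "gen_poly n \<nu> ?e" and ?p1 = "\<lambda>i. gen_poly n (link {i} \<nu>) ?e"
    and ?p2 = "\<lambda>i j. gen_poly n (link {i} (link {j} \<nu>)) ?e"
  have hessian_eq: "hessian (\<lambda>x. ln (gen_poly n \<nu> x)) ?e i j = (?p * ?p2 i j - ?p1 i * ?p1 j) / ?p\<^sup>2"
    if "i \<in> {1..n}" "j \<in> {1..n}" for i j
    using that pos
    by (subst hessian_ln) (auto simp: hessian_def partial_gen_poly intro: has_real_derivative_gen_poly)
  have "neg_semidef n (hessian (\<lambda>x. ln (gen_poly n \<nu> x)) ?e)"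
    using log_concave pos by (auto simp: log_concave_at_one_def)
  then have "0 \<ge> (\<Sum>i=1..n. \<Sum>j=1..n. v i * hessian (\<lambda>x. ln (gen_poly n \<nu> x)) ?e i j * v j)"
    unfolding neg_semidef_def by blast
  also have "(\<Sum>i=1..n. \<Sum>j=1..n. v i * hessian (\<lambda>x. ln (gen_poly n \<nu> x)) ?e i j * v j)
      = (\<Sum>i=1..n. \<Sum>j=1..n. (?p * (v i * ?p2 i j * v j) - (v i * ?p1 i) * (v j * ?p1 j)) / ?p\<^sup>2)"
    by (intro sum.cong refl) (simp add: hessian_eq algebra_simps)
  also have "\<dots> = (?p * (\<Sum>i=1..n. \<Sum>j=1..n. v i * ?p2 i j * v j) - (\<Sum>i=1..n. v i * ?p1 i)\<^sup>2) / ?p\<^sup>2"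
    unfolding power2_eq_square[of "sum _ _"] sum_product
    by (simp only: sum_subtractf sum_distrib_left sum_divide_distrib[symmetric])
  finally show ?thesis using pos by (simp add: divide_le_0_iff)
qed

lemma finite_supersets: "finite A \<Longrightarrow> finite {T..A}"
  by (rule finite_subset[of _ "Pow A"]) auto

lemma marginal_nonneg: "prob_dist n \<mu> \<Longrightarrow> 0 \<le> marginal n \<mu> T"
  by (auto simp: marginal_def prob_dist_def intro!: sum_nonneg)

lemma marginal_antimono: "prob_dist n \<mu> \<Longrightarrow> T \<subseteq> T' \<Longrightarrow> marginal n \<mu> T' \<le> marginal n \<mu> T"
  unfolding marginal_def by (intro sum_mono2) (auto simp: prob_dist_def finite_supersets)

lemma marginal_log_concave:
  assumes slc: "strongly_log_concave_at_one n (gen_poly n \<mu>)"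
    and T_subset: "T \<subseteq> {1..n}" and pos: "0 < marginal n \<mu> T"
  shows "marginal n \<mu> T * (\<Sum>i\<in>{1..n} - T. \<Sum>j\<in>{1..n} - insert i T.
      marginal n \<mu> (insert j (insert i T)) * v i * v j)
    \<le> (\<Sum>i\<in>{1..n} - T. marginal n \<mu> (insert i T) * v i)\<^sup>2"
proof -
  let ?\<nu> = "link T \<mu>" and ?e = "\<lambda>_. 1 :: real"
  obtain xs where xs_enum: "set xs = T" "distinct xs"
    using finite_distinct_list[of T] T_subset finite_subset by blast
  have log_concave: "log_concave_at_one n (gen_poly n ?\<nu>)"
    using slc T_subset xs_enum foldr_partial_gen_poly[of xs n \<mu>]
    by (metis strongly_log_concave_at_one_def)
  have at_one: "gen_poly n ?\<nu> ?e = marginal n \<mu> T" using T_subset by (rule gen_poly_link_one)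
  have gradient: "(\<Sum>i=1..n. v i * gen_poly n (link {i} ?\<nu>) ?e)
      = (\<Sum>i\<in>{1..n} - T. marginal n \<mu> (insert i T) * v i)"
    using T_subset by (intro sum.mono_neutral_cong_right)
      (auto simp: link_singleton_link gen_poly_zero gen_poly_link_one)
  have second_derivative: "gen_poly n (link {i} (link {j} ?\<nu>)) ?e
      = (if i \<in> T \<or> j \<in> insert i T then 0 else marginal n \<mu> (insert j (insert i T)))"
    if "i \<in> {1..n}" "j \<in> {1..n}" for i j
    using that T_subset
    by (cases "j \<in> T")
      (auto simp: link_singleton_link gen_poly_zero gen_poly_link_one link_zero insert_commute)
  have "(\<Sum>i=1..n. \<Sum>j=1..n. v i * gen_poly n (link {i} (link {j} ?\<nu>)) ?e * v j)
      = (\<Sum>i\<in>{1..n} - T. \<Sum>j\<in>{1..n} - insert i T. marginal n \<mu> (insert j (insert i T)) * v i * v j)"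
    by (intro sum.mono_neutral_cong_right)
      (auto simp: second_derivative intro!: sum.mono_neutral_cong_right)
  then show ?thesis
    using log_concave_gen_polyD[OF log_concave, of v] pos by (simp only: at_one gradient)
qed

section \<open>Norm bounds for adjoint raising and lowering operators\<close>

text \<open>
  The bound \<open>up_norm_le\<close> is the input from log-concavity. It propagates upwards from level \<open>k\<close> for the
  elements of level \<open>j\<close> that are orthogonal to everything raised from level \<open>k\<close>.
\<close>

locale graded_adjoint_pair =
  fixes B :: "nat \<Rightarrow> 'v \<Rightarrow> 'v \<Rightarrow> real" and U D :: "'v \<Rightarrow> 'v" and d :: nat
  assumes commute: "B j f g = B j g f"
    and nonneg: "0 \<le> B j f f"
    and Cauchy_Schwarz: "(B j f g)\<^sup>2 \<le> B j f f * B j g g"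
    and adjoint: "B j (D f) g = B (Suc j) f (U g)"
    and up_norm_le: "Suc j < d \<Longrightarrow> B (Suc (Suc j)) (U f) (U f) \<le> B j (D f) (D f) + B (Suc j) f f"
begin

lemma funpow_adjoint: "B j ((D ^^ m) f) g = B (j + m) f ((U ^^ m) g)"
proof (induction m arbitrary: j g)
  case (Suc m)
  have "B j ((D ^^ Suc m) f) g = B (Suc j) ((D ^^ m) f) (U g)" by (simp add: adjoint)
  also have "\<dots> = B (j + Suc m) f ((U ^^ Suc m) g)" unfolding Suc by (simp add: funpow_swap1)
  finally show ?case .
qed simp

lemma down_norm_le_if_up_norm_le:
  assumes "B (Suc j) (U (D f)) (U (D f)) \<le> a * B j (D f) (D f)" and "0 \<le> a"
  shows "B j (D f) (D f) \<le> a * B (Suc j) f f"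
proof -
  let ?x = "B j (D f) (D f)" and ?y = "B (Suc j) f f"
  have "?x * ?x = (B (Suc j) f (U (D f)))\<^sup>2" by (simp add: adjoint power2_eq_square)
  also have "\<dots> \<le> ?y * B (Suc j) (U (D f)) (U (D f))" by (rule Cauchy_Schwarz)
  also have "\<dots> \<le> ?y * (a * ?x)" by (intro mult_left_mono assms nonneg)
  finally have "?x * ?x \<le> (a * ?y) * ?x" by (simp add: mult_ac)
  moreover have "0 \<le> ?x" "0 \<le> a * ?y" using nonneg assms(2) by simp_all
  ultimately show ?thesis using mult_le_cancel_right[of ?x ?x "a * ?y"] by linarith
qed

lemma up_norm_le_if_orthogonal:
  assumes "k \<le> j" "j < d" and "\<And>g. B j f ((U ^^ (j - k)) g) = 0"
  shows "B (Suc j) (U f) (U f) \<le> (real j - real k) * B j f f"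
  using assms
proof (induction j arbitrary: f rule: dec_induct)
  case base
  have "B (Suc k) (U f) (U f) = B k f (D (U f))" by (simp only: adjoint[symmetric] commute[of k f])
  then show ?case using base(2)[of "D (U f)"] by simp
next
  case (step j)
  have "B j (D f) ((U ^^ (j - k)) g) = 0" for g
    using step.prems(2)[of g] step.hyps by (simp add: adjoint Suc_diff_le)
  then have "B (Suc j) (U (D f)) (U (D f)) \<le> (real j - real k) * B j (D f) (D f)"
    using step.prems(1) by (intro step.IH) auto
  then have "B j (D f) (D f) \<le> (real j - real k) * B (Suc j) f f"
    using step.hyps by (intro down_norm_le_if_up_norm_le) auto
  then show ?case using up_norm_le[of j f] step.prems(1) by (simp add: algebra_simps)
qed

lemma down_norm_le_if_orthogonal:
  assumes "k \<le> j" "j < d" and orthogonal: "\<And>g. B (Suc j) f ((U ^^ (Suc j - k)) g) = 0"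
  shows "B j (D f) (D f) \<le> (real j - real k) * B (Suc j) f f"
proof (rule down_norm_le_if_up_norm_le)
  have "B j (D f) ((U ^^ (j - k)) g) = 0" for g
    using orthogonal[of g] assms(1) by (simp add: adjoint Suc_diff_le)
  then show "B (Suc j) (U (D f)) (U (D f)) \<le> (real j - real k) * B j (D f) (D f)"
    using assms(1,2) by (intro up_norm_le_if_orthogonal)
qed (use assms(1) in simp)

end

section \<open>Walks between levels\<close>

lemma sum_nsets_Suc:
  fixes F :: "'a set \<Rightarrow> 'a \<Rightarrow> 'b :: comm_monoid_add"
  assumes "finite A"
  shows "(\<Sum>S\<in>nsets A (Suc j). \<Sum>i\<in>S. F (S - {i}) i) = (\<Sum>T\<in>nsets A j. \<Sum>i\<in>A - T. F T i)"
proof -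
  have "(\<Sum>S\<in>nsets A (Suc j). \<Sum>i\<in>S. F (S - {i}) i)
      = (\<Sum>(S, i)\<in>(SIGMA S:nsets A (Suc j). S). F (S - {i}) i)"
    using assms by (intro sum.Sigma finite_imp_finite_nsets) (auto simp: nsets_def)
  also have "\<dots> = (\<Sum>(T, i)\<in>(SIGMA T:nsets A j. A - T). F T i)"
    by (rule sum.reindex_bij_witness[of _ "\<lambda>(T, i). (insert i T, i)" "\<lambda>(S, i). (S - {i}, i)"])
      (auto simp: nsets_def insert_absorb card_insert_if)
  also have "\<dots> = (\<Sum>T\<in>nsets A j. \<Sum>i\<in>A - T. F T i)"
    using assms by (intro sum.Sigma[symmetric] finite_imp_finite_nsets) auto
  finally show ?thesis .
qed

lemma sum_off_diagonal:
  fixes f :: "'a \<Rightarrow> 'a \<Rightarrow> 'b :: comm_monoid_add"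
  assumes "finite A"
  shows "(\<Sum>i\<in>A. \<Sum>j\<in>A - {i}. f i j) = (\<Sum>i\<in>A. \<Sum>j\<in>A. if i = j then 0 else f i j)"
  using assms by (intro sum.cong refl sum.mono_neutral_cong_left) auto

text \<open>
  The all-ones vector is mapped by the form to its gradient, so completing the square relative to
  the weighted mean of \<open>v\<close> reduces the inequality to the tangent hyperplane.
\<close>

lemma quadratic_form_le_if_nonpos_on_tangent:
  fixes q :: "'a \<Rightarrow> 'a \<Rightarrow> real"
  assumes symmetric: "\<And>i j. i \<in> A \<Longrightarrow> j \<in> A \<Longrightarrow> q i j = q j i"
    and row: "\<And>i. i \<in> A \<Longrightarrow> (\<Sum>j\<in>A. q i j) = w i"
    and total: "sum w A = W" and "0 < W"
    and tangent: "\<And>u. (\<Sum>i\<in>A. w i * u i) = 0 \<Longrightarrow> (\<Sum>i\<in>A. \<Sum>j\<in>A. q i j * u i * u j) \<le> 0"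
  shows "(\<Sum>i\<in>A. \<Sum>j\<in>A. q i j * v i * v j) \<le> (\<Sum>i\<in>A. w i * v i)\<^sup>2 / W"
proof -
  define c where "c = (\<Sum>i\<in>A. w i * v i) / W"
  define u where "u i = v i - c" for i
  have mean_eq: "(\<Sum>i\<in>A. w i * v i) = c * W" using \<open>0 < W\<close> by (simp add: c_def)
  have "(\<Sum>i\<in>A. w i * u i) = 0"
    using mean_eq total
    by (simp add: u_def right_diff_distrib sum_subtractf flip: sum_distrib_right)
  then have "0 \<ge> (\<Sum>i\<in>A. \<Sum>j\<in>A. q i j * u i * u j)" by (rule tangent)
  also have "(\<Sum>i\<in>A. \<Sum>j\<in>A. q i j * u i * u j)
      = (\<Sum>i\<in>A. \<Sum>j\<in>A. q i j * v i * v j - c * (q i j * v i) - c * (q i j * v j) + c\<^sup>2 * q i j)"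
    by (intro sum.cong refl) (simp add: u_def algebra_simps power2_eq_square)
  also have "\<dots> = (\<Sum>i\<in>A. \<Sum>j\<in>A. q i j * v i * v j) - c * (\<Sum>i\<in>A. \<Sum>j\<in>A. q i j * v i)
      - c * (\<Sum>i\<in>A. \<Sum>j\<in>A. q i j * v j) + c\<^sup>2 * (\<Sum>i\<in>A. \<Sum>j\<in>A. q i j)"
    by (simp only: sum.distrib sum_subtractf sum_distrib_left)
  also have "(\<Sum>i\<in>A. \<Sum>j\<in>A. q i j * v j) = (\<Sum>j\<in>A. \<Sum>i\<in>A. q j i * v j)"
    by (subst sum.swap) (intro sum.cong refl, simp add: symmetric)
  also have "(\<Sum>i\<in>A. \<Sum>j\<in>A. q i j * v i) = c * W"
    by (simp add: row mean_eq flip: sum_distrib_right)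
  also have "(\<Sum>i\<in>A. \<Sum>j\<in>A. q i j) = W" by (simp add: row total)
  finally have "(\<Sum>i\<in>A. \<Sum>j\<in>A. q i j * v i * v j) \<le> c\<^sup>2 * W" by (simp add: power2_eq_square mult_ac)
  also have "c\<^sup>2 * W = (\<Sum>i\<in>A. w i * v i)\<^sup>2 / W"
    using \<open>0 < W\<close> by (simp add: c_def power_divide power2_eq_square)
  finally show ?thesis .
qed

locale homogeneous_distribution =
  fixes n d :: nat and \<mu> :: "nat set \<Rightarrow> real"
  assumes d_pos: "1 \<le> d" and prob: "prob_dist n \<mu>" and homog: "homogeneous n d \<mu>"
begin

definition weight :: "nat set \<Rightarrow> real" where
  "weight T = fact (d - card T) * marginal n \<mu> T"

definition down :: "(nat set \<Rightarrow> real) \<Rightarrow> nat set \<Rightarrow> real" where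
  "down g T = (\<Sum>i\<in>{1..n} - T. weight (insert i T) * g (insert i T)) / weight T"

definition up :: "(nat set \<Rightarrow> real) \<Rightarrow> nat set \<Rightarrow> real" where
  "up h S = (\<Sum>i\<in>S. h (S - {i}))"

definition level_ip :: "nat \<Rightarrow> (nat set \<Rightarrow> real) \<Rightarrow> (nat set \<Rightarrow> real) \<Rightarrow> real" where
  "level_ip j = weighted_ip (nsets {1..n} j) weight"

definition local_form :: "nat set \<Rightarrow> (nat \<Rightarrow> real) \<Rightarrow> real" where
  "local_form R v =
    (\<Sum>k\<in>{1..n} - R. \<Sum>i\<in>{1..n} - insert k R. weight (insert i (insert k R)) * v k * v i)"

lemma card_support: "S \<subseteq> {1..n} \<Longrightarrow> \<mu> S \<noteq> 0 \<Longrightarrow> card S = d"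
  using prob homog unfolding prob_dist_def homogeneous_def by (metis order_less_le)

lemma sum_marginal_insert:
  assumes T_subset: "T \<subseteq> {1..n}"
  shows "(\<Sum>i\<in>{1..n} - T. marginal n \<mu> (insert i T)) = real (d - card T) * marginal n \<mu> T"
proof -
  have "{insert i T..{1..n}} = {S \<in> {T..{1..n}}. i \<in> S}" for i by (auto simp: subset_iff)
  then have "(\<Sum>i\<in>{1..n} - T. marginal n \<mu> (insert i T))
      = (\<Sum>S\<in>{T..{1..n}}. \<Sum>i | i \<in> {1..n} - T \<and> i \<in> S. \<mu> S)"
    unfolding marginal_def by (simp only:) (rule sum.swap_restrict, auto simp: finite_supersets)
  also have "\<dots> = (\<Sum>S\<in>{T..{1..n}}. real (d - card T) * \<mu> S)"
  proof (intro sum.cong refl)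
    fix S assume S_mem: "S \<in> {T..{1..n}}"
    then have "{i. i \<in> {1..n} - T \<and> i \<in> S} = S - T" by auto
    then have "(\<Sum>i | i \<in> {1..n} - T \<and> i \<in> S. \<mu> S) = real (card S - card T) * \<mu> S"
      using S_mem T_subset by (simp add: card_Diff_subset finite_subset[of T])
    then show "(\<Sum>i | i \<in> {1..n} - T \<and> i \<in> S. \<mu> S) = real (d - card T) * \<mu> S"
      using card_support[of S] S_mem by auto
  qed
  finally show ?thesis by (simp add: marginal_def sum_distrib_left)
qed

lemma weight_nonneg: "0 \<le> weight T"
  by (simp add: weight_def marginal_nonneg[OF prob])

lemma weight_insert_eq_0: "weight T = 0 \<Longrightarrow> weight (insert i T) = 0"
  using marginal_antimono[OF prob, of T "insert i T"] marginal_nonneg[OF prob, of "insert i T"]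
  by (auto simp: weight_def)

lemma sum_weight_insert:
  assumes T_subset: "T \<subseteq> {1..n}" and card_less: "card T < d"
  shows "(\<Sum>i\<in>{1..n} - T. weight (insert i T)) = weight T"
proof -
  have "finite T" using T_subset finite_subset by blast
  then have "(\<Sum>i\<in>{1..n} - T. weight (insert i T))
      = fact (d - Suc (card T)) * (\<Sum>i\<in>{1..n} - T. marginal n \<mu> (insert i T))"
    by (simp add: weight_def sum_distrib_left)
  also have "\<dots> = weight T"
    unfolding sum_marginal_insert[OF T_subset] using card_less
    by (simp add: weight_def fact_reduce[of "d - card T"])
  finally show ?thesis .
qed

lemma weight_mult_down:
  "weight T * down g T = (\<Sum>i\<in>{1..n} - T. weight (insert i T) * g (insert i T))"
  by (cases "weight T = 0") (simp_all add: down_def weight_insert_eq_0)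

lemma down_one: "T \<subseteq> {1..n} \<Longrightarrow> card T < d \<Longrightarrow> weight T \<noteq> 0 \<Longrightarrow> down (\<lambda>_. 1) T = 1"
  by (simp add: down_def sum_weight_insert del: One_nat_def)

lemma level_ip_down: "level_ip j (down g) h = level_ip (Suc j) g (up h)"
proof -
  have "level_ip (Suc j) g (up h) = (\<Sum>S\<in>nsets {1..n} (Suc j). \<Sum>i\<in>S.
      weight (insert i (S - {i})) * g (insert i (S - {i})) * h (S - {i}))"
    unfolding level_ip_def weighted_ip_def up_def sum_distrib_left
    by (intro sum.cong refl) (simp add: insert_absorb)
  also have "\<dots> = (\<Sum>T\<in>nsets {1..n} j. \<Sum>i\<in>{1..n} - T. weight (insert i T) * g (insert i T) * h T)"
    by (rule sum_nsets_Suc) simp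
  also have "\<dots> = level_ip j (down g) h"
    by (simp add: level_ip_def weighted_ip_def weight_mult_down sum_distrib_right)
  finally show ?thesis by simp
qed

lemma weight_mult_down_up:
  assumes T_below_top: "T \<subseteq> {1..n}" "card T < d"
  shows "weight T * down (up h) T = weight T * h T
    + (\<Sum>k\<in>T. \<Sum>i\<in>{1..n} - T. weight (insert i T) * h (insert i (T - {k})))"
proof -
  have up_insert: "up h (insert i T) = h T + (\<Sum>k\<in>T. h (insert i (T - {k})))" if "i \<in> {1..n} - T" for i
  proof -
    have "up h (insert i T) = h (insert i T - {i}) + (\<Sum>k\<in>T. h (insert i T - {k}))"
      unfolding up_def using that T_below_top finite_subset[of T] by (subst sum.insert) auto
    also have "(\<Sum>k\<in>T. h (insert i T - {k})) = (\<Sum>k\<in>T. h (insert i (T - {k})))"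
      using that by (intro sum.cong refl arg_cong[of _ _ h]) auto
    finally show ?thesis using that by simp
  qed
  have "weight T * down (up h) T
      = (\<Sum>i\<in>{1..n} - T. weight (insert i T) * h T
          + (\<Sum>k\<in>T. weight (insert i T) * h (insert i (T - {k}))))"
    unfolding weight_mult_down
    by (intro sum.cong refl) (simp add: up_insert distrib_left sum_distrib_left)
  also have "\<dots> = weight T * h T
      + (\<Sum>i\<in>{1..n} - T. \<Sum>k\<in>T. weight (insert i T) * h (insert i (T - {k})))"
    by (simp add: sum.distrib sum_weight_insert[OF T_below_top] flip: sum_distrib_right del: One_nat_def)
  also have "(\<Sum>i\<in>{1..n} - T. \<Sum>k\<in>T. weight (insert i T) * h (insert i (T - {k})))
      = (\<Sum>k\<in>T. \<Sum>i\<in>{1..n} - T. weight (insert i T) * h (insert i (T - {k})))"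
    by (rule sum.swap)
  finally show ?thesis .
qed

lemma level_ip_up_up:
  assumes "Suc j < d"
  shows "level_ip (Suc (Suc j)) (up h) (up h) = level_ip (Suc j) h h
    + (\<Sum>R\<in>nsets {1..n} j. local_form R (\<lambda>i. h (insert i R)))"
proof -
  let ?F = "\<lambda>R k. \<Sum>i\<in>{1..n} - insert k R.
    weight (insert i (insert k R)) * h (insert k R) * h (insert i R)"
  have "level_ip (Suc (Suc j)) (up h) (up h) = (\<Sum>T\<in>nsets {1..n} (Suc j). weight T * down (up h) T * h T)"
    unfolding level_ip_down[symmetric] by (simp add: level_ip_def weighted_ip_def)
  also have "\<dots> = (\<Sum>T\<in>nsets {1..n} (Suc j). weight T * h T * h T + (\<Sum>k\<in>T. ?F (T - {k}) k))"
  proof (intro sum.cong refl)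
    fix T assume "T \<in> nsets {1..n} (Suc j)"
    then have "weight T * down (up h) T * h T = weight T * h T * h T
        + (\<Sum>k\<in>T. \<Sum>i\<in>{1..n} - T. weight (insert i T) * h T * h (insert i (T - {k})))"
      using assms by (subst weight_mult_down_up)
        (auto simp: nsets_def algebra_simps sum_distrib_left)
    also have "(\<Sum>k\<in>T. \<Sum>i\<in>{1..n} - T. weight (insert i T) * h T * h (insert i (T - {k})))
        = (\<Sum>k\<in>T. ?F (T - {k}) k)"
      by (intro sum.cong refl) (auto simp: insert_absorb)
    finally show "weight T * down (up h) T * h T = weight T * h T * h T + (\<Sum>k\<in>T. ?F (T - {k}) k)" .
  qed
  also have "\<dots> = level_ip (Suc j) h h + (\<Sum>T\<in>nsets {1..n} (Suc j). \<Sum>k\<in>T. ?F (T - {k}) k)"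
    by (simp add: sum.distrib level_ip_def weighted_ip_def)
  also have "(\<Sum>T\<in>nsets {1..n} (Suc j). \<Sum>k\<in>T. ?F (T - {k}) k)
      = (\<Sum>R\<in>nsets {1..n} j. \<Sum>k\<in>{1..n} - R. ?F R k)"
    by (rule sum_nsets_Suc) simp
  finally show ?thesis by (simp only: local_form_def)
qed

lemma funpow_up_from_level_0: "finite S \<Longrightarrow> (up ^^ card S) g S = fact (card S) * g {}"
proof (induction "card S" arbitrary: S)
  case (Suc m)
  have "(up ^^ Suc m) g S = (\<Sum>i\<in>S. (up ^^ m) g (S - {i}))" by (simp add: up_def)
  also have "\<dots> = (\<Sum>i\<in>S. fact m * g {})"
  proof (intro sum.cong refl)
    fix i assume "i \<in> S"
    then have "m = card (S - {i})" using Suc by simp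
    then show "(up ^^ m) g (S - {i}) = fact m * g {}" using Suc by simp
  qed
  also have "\<dots> = real (Suc m) * (fact m * g {})" by (simp only: sum_constant Suc(2))
  finally show ?case unfolding Suc(2)[symmetric] by (simp add: algebra_simps)
qed simp

end

locale slc_distribution = homogeneous_distribution +
  assumes slc: "strongly_log_concave_at_one n (gen_poly n \<mu>)"
begin

lemma local_form_nonpos_on_tangent:
  assumes R_subset: "R \<subseteq> {1..n}" and card_less: "Suc (card R) < d" and weight_R_pos: "0 < weight R"
    and tangent: "(\<Sum>i\<in>{1..n} - R. weight (insert i R) * u i) = 0"
  shows "local_form R u \<le> 0"
proof -
  let ?q = "\<Sum>k\<in>{1..n} - R. \<Sum>i\<in>{1..n} - insert k R. marginal n \<mu> (insert i (insert k R)) * u k * u i"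
  have finite_R: "finite R" using R_subset finite_subset by blast
  have marginal_pos: "0 < marginal n \<mu> R"
    using weight_R_pos by (simp add: weight_def zero_less_mult_iff)
  have "(\<Sum>i\<in>{1..n} - R. weight (insert i R) * u i)
      = fact (d - Suc (card R)) * (\<Sum>i\<in>{1..n} - R. marginal n \<mu> (insert i R) * u i)"
    using finite_R by (simp add: weight_def sum_distrib_left mult_ac)
  then have "marginal n \<mu> R * ?q \<le> 0"
    using marginal_log_concave[OF slc R_subset marginal_pos, of u] tangent by simp
  then have "?q \<le> 0" using marginal_pos by (simp add: mult_le_0_iff)
  moreover have "local_form R u = fact (d - Suc (Suc (card R))) * ?q"
    unfolding local_form_def sum_distrib_left using finite_R
    by (intro sum.cong refl) (auto simp: weight_def)
  ultimately show ?thesis by (simp add: mult_nonneg_nonpos)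
qed

lemma local_form_le:
  assumes R_subset: "R \<subseteq> {1..n}" and card_less: "Suc (card R) < d"
  shows "local_form R v \<le> (\<Sum>i\<in>{1..n} - R. weight (insert i R) * v i)\<^sup>2 / weight R"
proof (cases "weight R = 0")
  case True
  then show ?thesis by (simp add: local_form_def weight_insert_eq_0)
next
  case False
  let ?N = "{1..n} - R"
  let ?q = "\<lambda>k i. if k = i then 0 else weight (insert i (insert k R))"
  have weight_R_pos: "0 < weight R" using False weight_nonneg[of R] by simp
  have local_form_eq: "local_form R u = (\<Sum>k\<in>?N. \<Sum>i\<in>?N. ?q k i * u k * u i)" for u
    unfolding local_form_def Diff_insert[of _ _ R]
    by (subst sum_off_diagonal) (auto intro!: sum.cong)
  show ?thesis
    unfolding local_form_eq
  proof (rule quadratic_form_le_if_nonpos_on_tangent)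
    fix k assume k_mem: "k \<in> ?N"
    have "(\<Sum>i\<in>?N. ?q k i) = (\<Sum>i\<in>{1..n} - insert k R. weight (insert i (insert k R)))"
      by (intro sum.mono_neutral_cong_right) auto
    then show "(\<Sum>i\<in>?N. ?q k i) = weight (insert k R)"
      using sum_weight_insert[of "insert k R"] R_subset card_less k_mem finite_subset[OF R_subset]
      by simp
  next
    show "(\<Sum>k\<in>?N. weight (insert k R)) = weight R"
      using R_subset card_less by (intro sum_weight_insert) auto
  next
    fix u assume "(\<Sum>k\<in>?N. weight (insert k R) * u k) = 0"
    from local_form_nonpos_on_tangent[OF R_subset card_less weight_R_pos this]
    show "(\<Sum>k\<in>?N. \<Sum>i\<in>?N. ?q k i * u k * u i) \<le> 0" by (simp only: local_form_eq)
  qed (use weight_R_pos in \<open>auto simp: insert_commute\<close>)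
qed

lemma level_ip_up_le:
  assumes "Suc j < d"
  shows "level_ip (Suc (Suc j)) (up h) (up h) \<le> level_ip j (down h) (down h) + level_ip (Suc j) h h"
proof -
  have "(\<Sum>R\<in>nsets {1..n} j. local_form R (\<lambda>i. h (insert i R))) \<le> level_ip j (down h) (down h)"
    unfolding level_ip_def weighted_ip_def
  proof (intro sum_mono)
    fix R assume "R \<in> nsets {1..n} j"
    then have R_below_top: "R \<subseteq> {1..n}" "Suc (card R) < d" using assms by (auto simp: nsets_def)
    show "local_form R (\<lambda>i. h (insert i R)) \<le> weight R * down h R * down h R"
      using local_form_le[OF R_below_top, of "\<lambda>i. h (insert i R)"]
      by (cases "weight R = 0") (simp_all add: down_def power2_eq_square)
  qed
  then show ?thesis using assms by (simp add: level_ip_up_up)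
qed

sublocale levels: graded_adjoint_pair level_ip up down d
proof
  show "level_ip j f g = level_ip j g f" for j f g
    unfolding level_ip_def by (rule weighted_ip_commute)
  show "0 \<le> level_ip j f f" for j f
    unfolding level_ip_def by (intro weighted_ip_nonneg weight_nonneg)
  show "(level_ip j f g)\<^sup>2 \<le> level_ip j f f * level_ip j g g" for j f g
    unfolding level_ip_def by (intro weighted_ip_Cauchy_Schwarz weight_nonneg)
qed (fact level_ip_down level_ip_up_le)+

end

section \<open>The chain as a walk between the two top levels\<close>

context homogeneous_distribution
begin

lemma finite_supp: "finite (supp n \<mu>)"
  by (rule finite_subset[of _ "Pow {1..n}"]) (auto simp: supp_def)

lemma supp_pos: "S \<in> supp n \<mu> \<Longrightarrow> 0 < \<mu> S"
  using prob unfolding supp_def prob_dist_def by (simp add: order_less_le)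

lemma supp_subset_nsets: "supp n \<mu> \<subseteq> nsets {1..n} d"
  by (auto simp: supp_def nsets_def card_support intro: finite_subset)

lemma sum_supp: "sum \<mu> (supp n \<mu>) = 1"
proof -
  have "sum \<mu> (Pow {1..n}) = sum \<mu> (supp n \<mu>)"
    by (rule sum.mono_neutral_right) (auto simp: supp_def)
  then show ?thesis using prob by (simp add: prob_dist_def)
qed

lemma marginal_eq_sum_supp: "marginal n \<mu> T = (\<Sum>S | S \<in> supp n \<mu> \<and> T \<subseteq> S. \<mu> S)"
  unfolding marginal_def
  by (rule sum.mono_neutral_right) (auto simp: supp_def finite_supersets subset_iff)

lemma weight_pos_if_subset_supp: "S \<in> supp n \<mu> \<Longrightarrow> T \<subseteq> S \<Longrightarrow> 0 < weight T"
  unfolding weight_def marginal_eq_sum_supp using finite_supp supp_pos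
  by (intro mult_pos_pos sum_pos2[of _ S]) (auto simp: less_imp_le)

lemma weight_eq_0_if_not_face:
  assumes "T \<in> nsets {1..n} k" "T \<notin> faces n \<mu> k"
  shows "weight T = 0"
proof -
  have "marginal n \<mu> T = 0"
    unfolding marginal_eq_sum_supp using assms
    by (intro sum.neutral) (auto simp: faces_def nsets_def)
  then show ?thesis by (simp add: weight_def)
qed

lemma weight_top:
  assumes S_mem: "S \<in> nsets {1..n} d"
  shows "weight S = \<mu> S"
proof -
  have "S = S'" if "S' \<in> supp n \<mu>" "S \<subseteq> S'" for S'
  proof (rule card_subset_eq)
    have "S' \<in> nsets {1..n} d" using that(1) supp_subset_nsets by blast
    then show "finite S'" "card S = card S'" using S_mem by (simp_all add: nsets_def)
  qed (rule that(2))
  then have "{S' \<in> supp n \<mu>. S \<subseteq> S'} = (if \<mu> S = 0 then {} else {S})"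
    using S_mem by (auto simp: supp_def nsets_def)
  then show ?thesis using S_mem by (simp add: weight_def marginal_eq_sum_supp nsets_def)
qed

lemma level_ip_top: "level_ip d = weighted_ip (supp n \<mu>) \<mu>"
proof (intro ext)
  fix f g
  have "level_ip d f g = (\<Sum>S\<in>nsets {1..n} d. \<mu> S * f S * g S)"
    by (simp add: level_ip_def weighted_ip_def weight_top)
  also have "\<dots> = (\<Sum>S\<in>supp n \<mu>. \<mu> S * f S * g S)"
    using supp_subset_nsets
    by (intro sum.mono_neutral_right) (auto simp: finite_imp_finite_nsets supp_def nsets_def)
  finally show "level_ip d f g = weighted_ip (supp n \<mu>) \<mu> f g" by (simp add: weighted_ip_def)
qed

lemma supp_superset_eq_insert:
  assumes T_mem: "T \<in> nsets {1..n} (d - 1)" and S_superset: "S \<in> supp n \<mu>" "T \<subseteq> S"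
  shows "S \<in> (\<lambda>i. insert i T) ` ({1..n} - T)"
proof -
  have "finite T" "S \<subseteq> {1..n}" "card S = Suc (card T)"
    using T_mem S_superset(1) supp_subset_nsets d_pos by (auto simp: nsets_def)
  then have "card (S - T) = 1" using S_superset(2) by (simp add: card_Diff_subset)
  then obtain i where "S - T = {i}" by (auto simp: card_1_singleton_iff)
  then have "S = insert i T" "i \<in> {1..n} - T" using S_superset(2) \<open>S \<subseteq> {1..n}\<close> by auto
  then show ?thesis by blast
qed

lemma down_from_top:
  assumes T_mem: "T \<in> nsets {1..n} (d - 1)"
  shows "down f T = (\<Sum>S | S \<in> supp n \<mu> \<and> T \<subseteq> S. \<mu> S * f S) / marginal n \<mu> T"
proof -
  have T_card: "finite T" "card T = d - 1" "Suc (d - 1) = d"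
    using T_mem d_pos by (auto simp: nsets_def)
  have "(\<Sum>i\<in>{1..n} - T. weight (insert i T) * f (insert i T))
      = (\<Sum>i\<in>{1..n} - T. \<mu> (insert i T) * f (insert i T))"
    using T_mem T_card by (intro sum.cong refl) (subst weight_top, auto simp: nsets_def)
  also have "\<dots> = (\<Sum>S\<in>(\<lambda>i. insert i T) ` ({1..n} - T). \<mu> S * f S)"
    by (subst sum.reindex) (auto intro!: inj_onI)
  also have "\<dots> = (\<Sum>S | S \<in> supp n \<mu> \<and> T \<subseteq> S. \<mu> S * f S)"
    using T_mem supp_superset_eq_insert[OF T_mem]
    by (intro sum.mono_neutral_right) (auto simp: supp_def nsets_def)
  moreover have "weight T = marginal n \<mu> T" using T_card by (simp add: weight_def)
  ultimately show ?thesis by (simp add: down_def)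
qed

lemma kernel_op_chain:
  assumes S_mem: "S \<in> supp n \<mu>"
  shows "kernel_op (supp n \<mu>) (chain n \<mu>) f S = up (down f) S / real d"
proof -
  have S_top: "S \<subseteq> {1..n}" "card S = d" "finite S"
    using S_mem supp_subset_nsets by (auto simp: nsets_def)
  let ?g = "\<lambda>i S'. if S - {i} \<subseteq> S' then \<mu> S' * f S' else 0"
  have "kernel_op (supp n \<mu>) (chain n \<mu>) f S
      = (\<Sum>S'\<in>supp n \<mu>. \<Sum>i\<in>S. ?g i S' / marginal n \<mu> (S - {i}) / real d)"
    unfolding kernel_op_def chain_def sum_distrib_right marginal_eq_sum_supp[symmetric]
    using S_top by (intro sum.cong refl) (auto simp: field_simps)
  also have "\<dots> = (\<Sum>i\<in>S. \<Sum>S'\<in>supp n \<mu>. ?g i S' / marginal n \<mu> (S - {i}) / real d)"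
    by (rule sum.swap)
  also have "\<dots> = (\<Sum>i\<in>S. down f (S - {i}) / real d)"
  proof (intro sum.cong refl)
    fix i assume "i \<in> S"
    then have "S - {i} \<in> nsets {1..n} (d - 1)" using S_top by (auto simp: nsets_def)
    then have "down f (S - {i}) = (\<Sum>S'\<in>supp n \<mu>. ?g i S') / marginal n \<mu> (S - {i})"
      using finite_supp by (simp add: down_from_top sum.inter_filter)
    then show "(\<Sum>S'\<in>supp n \<mu>. ?g i S' / marginal n \<mu> (S - {i}) / real d) = down f (S - {i}) / real d"
      by (simp add: sum_divide_distrib)
  qed
  finally show ?thesis by (simp add: up_def sum_divide_distrib)
qed

lemma weighted_ip_chain:
  "weighted_ip (supp n \<mu>) \<mu> f (kernel_op (supp n \<mu>) (chain n \<mu>) g)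
    = level_ip (d - 1) (down f) (down g) / real d"
proof -
  have "weighted_ip (supp n \<mu>) \<mu> f (kernel_op (supp n \<mu>) (chain n \<mu>) g)
      = weighted_ip (supp n \<mu>) \<mu> f (\<lambda>S. 1 / real d * up (down g) S)"
    by (intro weighted_ip_cong) (simp_all add: kernel_op_chain)
  also have "\<dots> = level_ip d f (up (down g)) / real d"
    unfolding weighted_ip_scale_right level_ip_top by simp
  finally show ?thesis using level_ip_down[of "d - 1" f "down g"] d_pos by simp
qed

lemma chain_reversible:
  assumes "S \<in> supp n \<mu>" "S' \<in> supp n \<mu>"
  shows "\<mu> S * chain n \<mu> S S' = \<mu> S' * chain n \<mu> S' S"
proof -
  have flow_eq: "\<mu> A * chain n \<mu> A B
      = level_ip (d - 1) (down (indicator {A})) (down (indicator {B})) / real d"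
    if "A \<in> supp n \<mu>" "B \<in> supp n \<mu>" for A B
    unfolding weighted_ip_chain[symmetric] using that finite_supp
    by (simp add: weighted_ip_commute[of _ _ "indicator {A}"] weighted_ip_indicator kernel_op_indicator)
  show ?thesis
    using assms by (simp add: flow_eq) (simp add: level_ip_def weighted_ip_commute)
qed

sublocale reversible_chain "supp n \<mu>" \<mu> "chain n \<mu>"
proof
  show "kernel_op (supp n \<mu>) (chain n \<mu>) (\<lambda>_. 1) S = 1" if S_mem: "S \<in> supp n \<mu>" for S
  proof -
    have "S \<in> nsets {1..n} d" using S_mem supp_subset_nsets by blast
    moreover have "weight (S - {i}) \<noteq> 0" for i
      using weight_pos_if_subset_supp[OF S_mem, of "S - {i}"] by auto
    ultimately have "down (\<lambda>_. 1) (S - {i}) = 1" if "i \<in> S" for i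
      using that d_pos by (intro down_one) (auto simp: nsets_def)
    then show ?thesis
      using S_mem \<open>S \<in> nsets {1..n} d\<close> d_pos by (simp add: kernel_op_chain up_def nsets_def)
  qed
qed (auto simp: finite_supp supp_pos chain_reversible sum_supp)

end

context slc_distribution
begin

lemma orthogonal_to_lifted_faces:
  assumes k_le: "k \<le> d"
    and orthogonal: "\<And>T. T \<in> faces n \<mu> k \<Longrightarrow> level_ip d f ((up ^^ (d - k)) (indicator {T})) = 0"
  shows "level_ip d f ((up ^^ (d - k)) g) = 0"
proof -
  have lift_adjoint: "level_ip d f ((up ^^ (d - k)) h) = level_ip k ((down ^^ (d - k)) f) h" for h
    using k_le by (simp add: levels.funpow_adjoint)
  have "weight T * (down ^^ (d - k)) f T = 0" if T_mem: "T \<in> nsets {1..n} k" for T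
  proof (cases "T \<in> faces n \<mu> k")
    case True
    have "weight T * (down ^^ (d - k)) f T = level_ip k ((down ^^ (d - k)) f) (indicator {T})"
      unfolding level_ip_def using T_mem
      by (simp add: weighted_ip_indicator finite_imp_finite_nsets)
    then show ?thesis using orthogonal[OF True] by (simp add: lift_adjoint)
  qed (use T_mem weight_eq_0_if_not_face in simp)
  then have "(\<Sum>T\<in>nsets {1..n} k. weight T * (down ^^ (d - k)) f T * g T) = 0"
    by (intro sum.neutral) simp
  then show ?thesis unfolding lift_adjoint unfolding level_ip_def weighted_ip_def .
qed

lemma ip_app_le_if_orthogonal:
  assumes "k < d" and orthogonal: "\<And>g. level_ip d f ((up ^^ (d - k)) g) = 0"
  shows "ip f (app f) \<le> (1 - (real k + 1) / real d) * ip f f"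
proof -
  have Suc_pred_d: "Suc (d - 1) = d" using d_pos by simp
  have "level_ip (d - 1) (down f) (down f) \<le> (real (d - 1) - real k) * level_ip (Suc (d - 1)) f f"
  proof (rule levels.down_norm_le_if_orthogonal)
    show "level_ip (Suc (d - 1)) f ((up ^^ (Suc (d - 1) - k)) g) = 0" for g
      unfolding Suc_pred_d by (rule orthogonal)
  qed (use assms(1) in auto)
  then show ?thesis
    unfolding weighted_ip_chain Suc_pred_d level_ip_top using d_pos
    by (simp add: field_simps of_nat_diff)
qed

lemma eigenvalues_count:
  assumes "k < d"
  shows "size {#e \<in># eigenvalues (supp n \<mu>) (chain n \<mu>). e > 1 - (real k + 1) / real d#}
    \<le> card (faces n \<mu> k)"
proof (rule card_eigenvalues_gt_le_codimension[where \<psi> = "\<lambda>T. (up ^^ (d - k)) (indicator {T})"])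
  show "finite (faces n \<mu> k)"
    by (rule finite_subset[of _ "Pow {1..n}"]) (auto simp: faces_def)
  fix f assume orthogonal: "\<And>T. T \<in> faces n \<mu> k \<Longrightarrow> ip f ((up ^^ (d - k)) (indicator {T})) = 0"
  have "level_ip d f ((up ^^ (d - k)) g) = 0" for g
    by (rule orthogonal_to_lifted_faces) (use assms orthogonal in \<open>simp_all add: level_ip_top\<close>)
  with assms show "ip f (app f) \<le> (1 - (real k + 1) / real d) * ip f f"
    by (rule ip_app_le_if_orthogonal)
qed

lemma orthogonal_to_lifted_constants:
  assumes "ip f (\<lambda>_. 1) = 0"
  shows "level_ip d f ((up ^^ d) g) = 0"
proof -
  have "level_ip d f ((up ^^ d) g) = ip f (\<lambda>_. (fact d * g {}) * 1)"
    unfolding level_ip_top using supp_subset_nsets funpow_up_from_level_0[of _ g]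
    by (intro weighted_ip_cong) (auto simp: nsets_def)
  then show ?thesis using assms by (simp only: weighted_ip_scale_right)
qed

lemma app_contraction:
  assumes mean: "ip f (\<lambda>_. 1) = 0"
  shows "ip (app f) (app f) \<le> (1 - 1 / real d)\<^sup>2 * ip f f"
proof -
  let ?c = "real (d - 1) - real 0"
  have Suc_pred_d: "Suc (d - 1) = d" using d_pos by simp
  have orthogonal: "level_ip (Suc (d - 1)) f ((up ^^ (Suc (d - 1) - 0)) g) = 0" for g
    unfolding Suc_pred_d diff_zero by (rule orthogonal_to_lifted_constants[OF mean])
  then have orthogonal_down: "level_ip (d - 1) (down f) ((up ^^ (d - 1 - 0)) g) = 0" for g
    by (simp add: level_ip_down)
  have "ip (app f) (app f) = ip (\<lambda>S. 1 / real d * up (down f) S) (\<lambda>S. 1 / real d * up (down f) S)"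
    by (intro weighted_ip_cong) (simp_all add: kernel_op_chain)
  also have "\<dots> = (1 / real d)\<^sup>2 * level_ip (Suc (d - 1)) (up (down f)) (up (down f))"
    unfolding weighted_ip_scale_left weighted_ip_scale_right Suc_pred_d level_ip_top
    by (simp add: power2_eq_square)
  also have "\<dots> \<le> (1 / real d)\<^sup>2 * (?c * level_ip (d - 1) (down f) (down f))"
    using orthogonal_down d_pos by (intro mult_left_mono levels.up_norm_le_if_orthogonal) auto
  also have "\<dots> \<le> (1 / real d)\<^sup>2 * (?c * (?c * level_ip (Suc (d - 1)) f f))"
    using orthogonal d_pos by (intro mult_left_mono levels.down_norm_le_if_orthogonal) auto
  also have "\<dots> = (1 - 1 / real d)\<^sup>2 * ip f f"
    unfolding Suc_pred_d level_ip_top using d_pos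
    by (simp add: field_simps power2_eq_square of_nat_diff)
  finally show ?thesis .
qed

sublocale contracting_chain "supp n \<mu>" \<mu> "chain n \<mu>" "1 - 1 / real d"
  using d_pos by unfold_locales (auto simp: app_contraction)

end

lemma card_faces_le: "card (faces n \<mu> k) \<le> n choose k"
proof -
  have "card (faces n \<mu> k) \<le> card {T. T \<subseteq> {1..n} \<and> card T = k}"
    by (intro card_mono) (auto simp: faces_def)
  then show ?thesis by (simp add: n_subsets)
qed

theorem theorem1p1:
  fixes n d :: nat and \<mu> :: "nat set \<Rightarrow> real"
  assumes "1 \<le> d"
    and "prob_dist n \<mu>"
    and "homogeneous n d \<mu>"
    and "strongly_log_concave_at_one n (gen_poly n \<mu>)"
  shows "(\<forall>k<d. size {# e \<in># eigenvalues (supp n \<mu>) (chain n \<mu>). e > 1 - (real k + 1) / real d #}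
                  \<le> card (faces n \<mu> k)
              \<and> card (faces n \<mu> k) \<le> n choose k)
       \<and> spectral_gap (supp n \<mu>) (chain n \<mu>) \<ge> 1 / real d
       \<and> (\<forall>\<tau>\<in>supp n \<mu>. \<forall>\<epsilon>. 0 < \<epsilon> \<and> \<epsilon> < 1 \<longrightarrow>
            ereal_of_enat (mixing_time tv_dist (supp n \<mu>) (chain n \<mu>) \<tau> \<epsilon>)
              \<le> ereal (real d * ln (1 / (\<epsilon> * \<mu> \<tau>)))
          \<and> (d \<noteq> 1 \<longrightarrow>
              ereal_of_enat (mixing_time l1_dist (supp n \<mu>) (chain n \<mu>) \<tau> \<epsilon>)
                \<le> ereal (real d * ln (1 / (\<epsilon> * \<mu> \<tau>)))))"
proof -
  interpret slc_distribution n d \<mu> using assms by unfold_locales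
  have "size {#e \<in># eigenvalues (supp n \<mu>) (chain n \<mu>). e > 1 - 1 / real d#} \<le> 1"
    using eigenvalues_count[of 0] card_faces_le[of n \<mu> 0] \<open>1 \<le> d\<close> by simp
  from spectral_gap_ge[OF this] have "1 / real d \<le> spectral_gap (supp n \<mu>) (chain n \<mu>)"
    using \<open>1 \<le> d\<close> by simp
  moreover have "ereal_of_enat (mixing_time tv_dist (supp n \<mu>) (chain n \<mu>) \<tau> \<epsilon>)
      \<le> ereal (real d * ln (1 / (\<epsilon> * \<mu> \<tau>)))" if "\<tau> \<in> supp n \<mu>" "0 < \<epsilon>" "\<epsilon> < 1" for \<tau> \<epsilon>
    using that \<open>1 \<le> d\<close> by (intro tv_mixing_time_le) auto
  moreover have "ereal_of_enat (mixing_time l1_dist (supp n \<mu>) (chain n \<mu>) \<tau> \<epsilon>)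
      \<le> ereal (real d * ln (1 / (\<epsilon> * \<mu> \<tau>)))" if "\<tau> \<in> supp n \<mu>" "0 < \<epsilon>" "\<epsilon> < 1" "d \<noteq> 1" for \<tau> \<epsilon>
    using that \<open>1 \<le> d\<close> by (intro l1_mixing_time_le) auto
  ultimately show ?thesis using eigenvalues_count card_faces_le by simp
qed

end
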